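(* Let $P_5=\mathbb{F}_2[x_1,\dots,x_5]$, with each $x_i$ of degree $1$, regarded as a module over the mod 2 Steenrod algebra $\mathcal{A}$ and over $GL_5=GL_5(\mathbb{F}_2)$. Then $$(\mathbb{F}_2\otimes_{\mathcal{A}}P_5)^{GL_5}_{11}=0,$$ i.e. the only $GL_5$-invariant element of the degree-$11$ part of $\mathbb{F}_2\otimes_{\mathcal{A}}P_5$ is $0$.
   Context: $P_5=H^*(B\mathbb{V}_5;\mathbb{F}_2)$ where $\mathbb{V}_5$ is a $5$-dimensional $\mathbb{F}_2$-vector space. The Steenrod squares act on $P_5$ by $\mathrm{Sq}^0=\mathrm{id}$, $\mathrm{Sq}^1x_j=x_j^2$, $\mathrm{Sq}^ix_j=0$ for $i\geq 2$, and the Cartan formula $\mathrm{Sq}^n(fg)=\sum_{i}\mathrm{Sq}^i(f)\mathrm{Sq}^{n-i}(g)$. $\mathbb{F}_2\otimes_{\mathcal{A}}P_5$ is the quotient of $P_5$ by the subspace spanned by all $\mathrm{Sq}^i(f)$ with $i>0$, $f\in P_5$; a subscript $11$ denotes the degree-$11$ homogeneous part. $GL_5$ acts on $P_5$ by linear substitution of variables; this commutes with the action of $\mathcal{A}$, hence induces an action on $\mathbb{F}_2\otimes_{\mathcal{A}}P_5$. The superscript $GL_5$ denotes invariants. *)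

theory Defs
  imports
    "HOL-Analysis.Cartesian_Space"
    "HOL-Computational_Algebra.Polynomial"
    "HOL-Library.Poly_Mapping"
    "HOL-Library.Z2"
    "HOL-Library.Numeral_Type"
begin

section \<open>The polynomial ring in five variables over the field with two elements\<close>

text \<open>
  The numeral type \<^typ>\<open>5\<close> indexes the variables, exponent vectors are elements of
  \<^typ>\<open>5 \<Rightarrow>\<^sub>0 nat\<close>, and \<^typ>\<open>bit\<close> is the field with two elements.
\<close>

type_synonym P5 = "(5 \<Rightarrow>\<^sub>0 nat) \<Rightarrow>\<^sub>0 bit"

definition const :: "bit \<Rightarrow> P5" where
  "const c = Poly_Mapping.single 0 c"

definition var :: "5 \<Rightarrow> P5" where
  "var j = Poly_Mapping.single (Poly_Mapping.single j 1) 1"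

definition homogeneous :: "nat \<Rightarrow> P5 \<Rightarrow> bool" where
  "homogeneous d f \<longleftrightarrow> (\<forall>m\<in>Poly_Mapping.keys f. (\<Sum>j\<in>UNIV. Poly_Mapping.lookup m j) = d)"

definition P5_scale :: "bit \<Rightarrow> P5 \<Rightarrow> P5" where
  "P5_scale c f = const c * f"

lemma const_simps [simp]:
  "const 0 = 0" "const 1 = 1"
  by (simp_all add: const_def)

lemma const_add: "const (a + b) = const a + const b"
  by (simp only: const_def single_add)

lemma const_mult: "const (a * b) = const a * const b"
  by (simp add: const_def mult_single)

global_interpretation P5: vector_space P5_scale
  by unfold_locales
    (simp_all only: P5_scale_def const_add const_mult const_simps distrib_left distrib_right
      mult.assoc mult_1_left)

lemma P5_add_self: "f + f = (0 :: P5)"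
proof -
  have "f + f = const (1 + 1) * f"
    unfolding const_add by (simp add: algebra_simps)
  then show ?thesis
    by simp
qed

lemma P5_uminus: "- f = (f :: P5)"
  using P5_add_self[of f] by (simp add: eq_neg_iff_add_eq_0)

lemma prod_single_one:
  "finite A \<Longrightarrow> (\<Prod>j\<in>A. Poly_Mapping.single (g j) 1) = (Poly_Mapping.single (\<Sum>j\<in>A. g j) 1 :: P5)"
  by (induction A rule: finite_induct) (simp_all add: mult_single)

lemma var_power: "var j ^ k = Poly_Mapping.single (Poly_Mapping.single j k) 1"
  by (induction k) (simp_all add: var_def mult_single flip: single_add)

lemma monomial_eq_prod:
  "(Poly_Mapping.single m 1 :: P5) = (\<Prod>j\<in>UNIV. var j ^ Poly_Mapping.lookup m j)"
proof -
  have "m = (\<Sum>j\<in>UNIV. Poly_Mapping.single j (Poly_Mapping.lookup m j))"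
    by (rule poly_mapping_eqI) (simp add: lookup_sum lookup_single when_def)
  then show ?thesis
    by (simp add: var_power prod_single_one)
qed

lemma P5_induct [case_names zero one var add mult]:
  fixes f :: P5
  assumes zero: "P 0" and one: "P 1" and var: "\<And>j. P (var j)"
    and add: "\<And>f g. P f \<Longrightarrow> P g \<Longrightarrow> P (f + g)"
    and mult: "\<And>f g. P f \<Longrightarrow> P g \<Longrightarrow> P (f * g)"
  shows "P f"
proof -
  have pow: "P (f ^ k)" if "P f" for f k
    by (induction k) (auto intro: one mult that)
  have prod: "P (\<Prod>j\<in>A. h j)" if "finite A" "\<And>j. P (h j)" for A and h :: "5 \<Rightarrow> P5"
    using that(1) by (induction A rule: finite_induct) (auto intro: one mult that(2))
  have single: "P (Poly_Mapping.single m c)" for m c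
    by (cases c) (auto simp: zero monomial_eq_prod intro!: prod pow var)
  have sum: "P (\<Sum>m\<in>A. h m)" if "finite A" "\<And>m. P (h m)" for A and h :: "(5 \<Rightarrow>\<^sub>0 nat) \<Rightarrow> P5"
    using that(1) by (induction A rule: finite_induct) (auto intro: zero add that(2))
  have "f = (\<Sum>m\<in>Poly_Mapping.keys f. Poly_Mapping.single m (Poly_Mapping.lookup f m))"
    by (rule poly_mapping_eqI)
      (auto simp: lookup_sum lookup_single when_def in_keys_iff simp del: bit_not_zero_iff)
  with sum[of "Poly_Mapping.keys f"] single show ?thesis
    by (metis finite_keys)
qed


section \<open>Evaluation homomorphisms\<close>

definition eval_hom :: "(bit \<Rightarrow> 'r) \<Rightarrow> (5 \<Rightarrow> 'r) \<Rightarrow> P5 \<Rightarrow> 'r::comm_ring_1" where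
  "eval_hom h g f =
    (\<Sum>m\<in>Poly_Mapping.keys f. h (Poly_Mapping.lookup f m) * (\<Prod>j\<in>UNIV. g j ^ Poly_Mapping.lookup m j))"

locale scalar_hom =
  fixes h :: "bit \<Rightarrow> 'r::comm_ring_1"
  assumes h_zero [simp]: "h 0 = 0"
    and h_one [simp]: "h 1 = 1"
    and h_add: "h (a + b) = h a + h b"
begin

lemma eval_hom_zero [simp]: "eval_hom h g 0 = 0"
  by (simp add: eval_hom_def)

lemma eval_hom_single:
  "eval_hom h g (Poly_Mapping.single m c) = h c * (\<Prod>j\<in>UNIV. g j ^ Poly_Mapping.lookup m j)"
  by (cases c) (simp_all add: eval_hom_def)

lemma eval_hom_one [simp]: "eval_hom h g 1 = 1"
  using eval_hom_single[of g 0 1] by simp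

lemma eval_hom_var [simp]: "eval_hom h g (var j) = g j"
proof -
  have "(\<Prod>i\<in>UNIV. g i ^ Poly_Mapping.lookup (Poly_Mapping.single j 1) i)
      = (\<Prod>i\<in>UNIV. if i = j then g i else 1)"
    by (rule prod.cong) (auto simp: lookup_single when_def)
  then show ?thesis
    by (simp add: var_def eval_hom_single)
qed

lemma eval_hom_const [simp]: "eval_hom h g (const c) = h c"
  by (simp add: const_def eval_hom_single)

lemma eval_hom_add: "eval_hom h g (f1 + f2) = eval_hom h g f1 + eval_hom h g f2"
  unfolding eval_hom_def
  by (rule setsum_keys_plus_distrib) (simp_all only: h_zero h_add mult_zero_left distrib_right)

lemma update_eq_add:
  assumes "a \<notin> Poly_Mapping.keys f"
  shows "Poly_Mapping.update a b f = Poly_Mapping.single a b + f"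
  using assms
  by (intro poly_mapping_eqI)
    (auto simp: lookup_update lookup_add lookup_single when_def not_in_keys_iff_lookup_eq_zero)

lemma eval_hom_mult_single:
  "eval_hom h g (Poly_Mapping.single m 1 * f) = eval_hom h g (Poly_Mapping.single m 1) * eval_hom h g f"
proof (induction f rule: update_induct)
  case const
  then show ?case by simp
next
  case (update f a b)
  note eq = update_eq_add[OF update(1)]
  show ?case
    unfolding eq distrib_left eval_hom_add update
    by (simp add: mult_single eval_hom_single lookup_add power_add prod.distrib algebra_simps)
qed

lemma eval_hom_mult: "eval_hom h g (f1 * f2) = eval_hom h g f1 * eval_hom h g f2"
proof (induction f1 rule: update_induct)
  case const
  then show ?case by simp
next
  case (update f a b)
  note eq = update_eq_add[OF update(1)]
  from update have "b = 1" by simp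
  then show ?case
    unfolding eq distrib_right eval_hom_add update
    by (simp add: eval_hom_mult_single)
qed

end

interpretation const_hom: scalar_hom const
  by unfold_locales (simp_all only: const_simps const_add)

interpretation const_poly_hom: scalar_hom "\<lambda>c. [:const c:]"
proof
  show "[:const (a + b):] = [:const a:] + [:const b:]" for a b
    unfolding const_add by simp
qed simp_all


section \<open>Steenrod squares\<close>

definition steenrod_squares :: "(nat \<Rightarrow> P5 \<Rightarrow> P5) \<Rightarrow> bool" where
  "steenrod_squares S \<longleftrightarrow>
     (\<forall>n f g. S n (f + g) = S n f + S n g) \<and>
     (\<forall>f. S 0 f = f) \<and>
     (\<forall>j. S 1 (var j) = var j ^ 2) \<and>
     (\<forall>i\<ge>2. \<forall>j. S i (var j) = 0) \<and>
     (\<forall>n f g. S n (f * g) = (\<Sum>i\<le>n. S i f * S (n - i) g))"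

lemma cartan_family_unique:
  fixes S T :: "nat \<Rightarrow> P5 \<Rightarrow> 'r::comm_ring_1"
  assumes add: "\<And>n f g. S n (f + g) = S n f + S n g" "\<And>n f g. T n (f + g) = T n f + T n g"
    and cartan: "\<And>n f g. S n (f * g) = (\<Sum>i\<le>n. S i f * S (n - i) g)"
      "\<And>n f g. T n (f * g) = (\<Sum>i\<le>n. T i f * T (n - i) g)"
    and S1: "S 0 1 = 1" and T1: "T 0 1 = 1"
    and var: "\<And>n j. S n (var j) = T n (var j)"
  shows "S n f = T n f"
proof -
  have one0: "U n 1 = 0"
    if U: "\<And>n f g. U n (f * g) = (\<Sum>i\<le>n. U i f * U (n - i) g)" "U 0 1 = 1" and "n > 0"
    for U :: "nat \<Rightarrow> P5 \<Rightarrow> 'r" and n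
    using \<open>n > 0\<close>
  proof (induction n rule: less_induct)
    case (less n)
    have "U n 1 = (\<Sum>i\<le>n. U i 1 * U (n - i) 1)"
      using U(1)[of n 1 1] by simp
    also have "\<dots> = (\<Sum>i\<in>{0, n}. U i 1 * U (n - i) 1)"
    proof (rule sum.mono_neutral_right)
      show "\<forall>i\<in>{..n} - {0, n}. U i 1 * U (n - i) 1 = 0"
      proof
        fix i assume "i \<in> {..n} - {0, n}"
        then have "i < n" "0 < i" by auto
        then show "U i 1 * U (n - i) 1 = 0"
          using less.IH[of i] by simp
      qed
    qed auto
    also have "\<dots> = U n 1 + U n 1"
      using less.prems U(2) by simp
    finally show ?case by simp
  qed
  have zero: "S n 0 = 0" "T n 0 = 0" for n
    using add(1)[of n 0 0] add(2)[of n 0 0] by simp_all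
  have "\<forall>n. S n f = T n f"
  proof (induction f rule: P5_induct)
    case one
    show ?case
      using one0[of S, OF cartan(1) S1] one0[of T, OF cartan(2) T1] S1 T1
      by (metis not_gr_zero)
  qed (simp_all add: zero var add cartan)
  then show ?thesis by blast
qed

lemma steenrod_squaresD:
  assumes "steenrod_squares S"
  shows "S n (f + g) = S n f + S n g" "S 0 f = f" "S 1 (var j) = var j ^ 2"
    "i \<ge> 2 \<Longrightarrow> S i (var j) = 0" "S n (f * g) = (\<Sum>i\<le>n. S i f * S (n - i) g)"
  using assms unfolding steenrod_squares_def by blast+

lemma steenrod_squares_exists_unique: "\<exists>!S. steenrod_squares S"
proof (rule ex_ex1I)
  define tot :: "P5 \<Rightarrow> P5 poly"
    where "tot = eval_hom (\<lambda>c. [:const c:]) (\<lambda>j. [:var j, var j ^ 2:])"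
  define S where "S n f = coeff (tot f) n" for n f
  have "S 0 f = f" for f
    by (induction f rule: P5_induct)
      (simp_all add: S_def tot_def const_poly_hom.eval_hom_add const_poly_hom.eval_hom_mult
        coeff_mult)
  moreover have "S i (var j) = 0" if "i \<ge> 2" for i j
    using that by (simp add: S_def tot_def coeff_pCons split: nat.splits)
  ultimately have "steenrod_squares S"
    unfolding steenrod_squares_def
    by (auto simp: S_def tot_def const_poly_hom.eval_hom_add const_poly_hom.eval_hom_mult
        coeff_mult)
  then show "\<exists>S. steenrod_squares S"
    by blast
next
  fix S T assume S: "steenrod_squares S" and T: "steenrod_squares T"
  have var: "S n (var j) = T n (var j)" for n j
  proof -
    consider "n = 0" | "n = 1" | "n \<ge> 2" by linarith
    then show ?thesis
      by cases (simp_all only: steenrod_squaresD(2-4)[OF S] steenrod_squaresD(2-4)[OF T])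
  qed
  have "S n f = T n f" for n f
    by (rule cartan_family_unique[OF
          steenrod_squaresD(1)[OF S] steenrod_squaresD(1)[OF T]
          steenrod_squaresD(5)[OF S] steenrod_squaresD(5)[OF T]
          steenrod_squaresD(2)[OF S] steenrod_squaresD(2)[OF T] var])
  then show "S = T" by blast
qed

definition Sq :: "nat \<Rightarrow> P5 \<Rightarrow> P5" where
  "Sq = (THE S. steenrod_squares S)"

lemma steenrod_squares_Sq: "steenrod_squares Sq"
  unfolding Sq_def by (rule theI'[OF steenrod_squares_exists_unique])

lemma Sq_add: "Sq n (f + g) = Sq n f + Sq n g"
  and Sq_0: "Sq 0 f = f"
  and Sq_1_var: "Sq 1 (var j) = var j ^ 2"
  and Sq_var_ge2: "i \<ge> 2 \<Longrightarrow> Sq i (var j) = 0"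
  and Sq_mult: "Sq n (f * g) = (\<Sum>i\<le>n. Sq i f * Sq (n - i) g)"
  by (fact steenrod_squaresD[OF steenrod_squares_Sq])+

lemma Sq_zero [simp]: "Sq n 0 = 0"
  using Sq_add[of n 0 0] by (metis add_cancel_right_right)


section \<open>The action of the general linear group\<close>

definition GL5 :: "(bit ^ 5 ^ 5) set" where
  "GL5 = {A. invertible A}"

text \<open>The matrix \<open>A\<close> acts by the substitution \<open>x\<^sub>j \<mapsto> \<Sum>\<^sub>i A\<^sub>i\<^sub>j x\<^sub>i\<close>, which is a left action.\<close>

definition subst_action :: "bit ^ 5 ^ 5 \<Rightarrow> P5 \<Rightarrow> P5" where
  "subst_action A = eval_hom const (\<lambda>j. \<Sum>i\<in>UNIV. const (A $ i $ j) * var i)"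

lemma subst_action_simps [simp]:
  "subst_action A 0 = 0"
  "subst_action A 1 = 1"
  "subst_action A (const c) = const c"
  "subst_action A (var j) = (\<Sum>i\<in>UNIV. const (A $ i $ j) * var i)"
  "subst_action A (f + g) = subst_action A f + subst_action A g"
  "subst_action A (f * g) = subst_action A f * subst_action A g"
  by (simp_all add: subst_action_def const_hom.eval_hom_add const_hom.eval_hom_mult)

lemma subst_action_scale: "subst_action A (P5_scale c f) = P5_scale c (subst_action A f)"
  by (simp add: P5_scale_def)

lemma subst_action_sum: "subst_action A (\<Sum>i\<in>I. f i) = (\<Sum>i\<in>I. subst_action A (f i))"
  by (induction I rule: infinite_finite_induct) simp_all

lemma const_sum: "const (\<Sum>i\<in>I. f i) = (\<Sum>i\<in>I. const (f i))"
  by (induction I rule: infinite_finite_induct)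
    (simp_all only: const_simps const_add sum.infinite sum.empty sum.insert not_False_eq_True)

lemma subst_action_one: "subst_action (mat 1) f = f"
proof (induction f rule: P5_induct)
  case (var j)
  have "(\<Sum>i\<in>UNIV. const ((mat 1 :: bit ^ 5 ^ 5) $ i $ j) * var i)
      = (\<Sum>i\<in>UNIV. if i = j then var i else 0)"
    by (rule sum.cong) (auto simp: mat_def)
  then show ?case by simp
qed simp_all

lemma subst_action_matrix_mult:
  "subst_action (A ** B) f = subst_action A (subst_action B f)"
proof (induction f rule: P5_induct)
  case (var j)
  have "subst_action A (subst_action B (var j))
      = (\<Sum>i\<in>UNIV. \<Sum>k\<in>UNIV. const (A $ k $ i * B $ i $ j) * var k)"
    by (simp only: subst_action_simps subst_action_sum const_mult sum_distrib_left mult_ac)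
  also have "\<dots> = (\<Sum>k\<in>UNIV. \<Sum>i\<in>UNIV. const (A $ k $ i * B $ i $ j) * var k)"
    by (rule sum.swap)
  also have "\<dots> = subst_action (A ** B) (var j)"
    by (simp only: subst_action_simps matrix_matrix_mult_def const_sum sum_distrib_right vec_lambda_beta)
  finally show ?case ..
qed simp_all

lemma P5_square_add: "(f + g)\<^sup>2 = f\<^sup>2 + g\<^sup>2" for f g :: P5
proof -
  have "(f + g)\<^sup>2 = f\<^sup>2 + g\<^sup>2 + (f * g + f * g)"
    by (simp add: power2_eq_square algebra_simps)
  then show ?thesis by (simp only: P5_add_self add_0_right)
qed

lemma P5_square_sum: "(\<Sum>i\<in>I. f i)\<^sup>2 = (\<Sum>i\<in>I. (f i)\<^sup>2)" for f :: "'i \<Rightarrow> P5"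
  by (induction I rule: infinite_finite_induct) (simp_all add: P5_square_add)

lemma Sq_sum: "Sq n (\<Sum>i\<in>I. f i) = (\<Sum>i\<in>I. Sq n (f i))"
  by (induction I rule: infinite_finite_induct) (simp_all add: Sq_add)

lemma Sq_const_mult: "Sq n (const c * f) = const c * Sq n f"
  by (cases c) simp_all

lemma Sq_subst_action: "Sq n (subst_action A f) = subst_action A (Sq n f)"
proof (rule cartan_family_unique
    [where S = "\<lambda>n f. Sq n (subst_action A f)" and T = "\<lambda>n f. subst_action A (Sq n f)"])
  fix n :: nat and j
  let ?L = "\<Sum>i\<in>UNIV. const (A $ i $ j) * var i"
  have sq: "(const c)\<^sup>2 = const c" for c
    by (cases c) simp_all
  consider "n = 0" | "n = 1" | "n \<ge> 2" by linarith
  then show "Sq n (subst_action A (var j)) = subst_action A (Sq n (var j))"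
  proof cases
    case 1
    then show ?thesis by (simp add: Sq_0)
  next
    case 2
    have "Sq 1 ?L = ?L\<^sup>2"
      by (simp add: Sq_sum Sq_const_mult Sq_1_var[simplified] P5_square_sum power_mult_distrib sq)
    moreover have "subst_action A (Sq 1 (var j)) = ?L\<^sup>2"
      unfolding Sq_1_var by (simp add: power2_eq_square)
    ultimately show ?thesis using 2 by simp
  next
    case 3
    then show ?thesis by (simp add: Sq_sum Sq_const_mult Sq_var_ge2)
  qed
qed (simp_all only: subst_action_simps Sq_add Sq_0 Sq_mult subst_action_sum)


section \<open>The quotient by the action of the Steenrod algebra\<close>

definition hit :: "P5 set" where
  "hit = P5.span {Sq i f | i f. i > 0}"

text \<open>
  The type \<open>cohit\<close> is \<open>\<bbbF>\<^sub>2 \<otimes>\<^sub>\<A> P\<^sub>5\<close>, the quotient of \<open>P\<^sub>5\<close> by the subspace \<^const>\<open>hit\<close>.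
\<close>

quotient_type cohit = P5 / "\<lambda>f g. f - g \<in> hit"
proof (rule equivpI)
  show "reflp (\<lambda>f g. f - g \<in> hit)"
    by (rule reflpI) (simp add: hit_def P5.span_zero)
  show "symp (\<lambda>f g. f - g \<in> hit)"
    unfolding hit_def by (rule sympI) (drule P5.span_neg, simp only: minus_diff_eq)
  show "transp (\<lambda>f g. f - g \<in> hit)"
    unfolding hit_def by (rule transpI) (drule (1) P5.span_add, simp)
qed

instantiation cohit :: ab_group_add
begin

lift_definition zero_cohit :: cohit is 0 .

lift_definition plus_cohit :: "cohit \<Rightarrow> cohit \<Rightarrow> cohit" is "(+)"
  unfolding hit_def by (drule (1) P5.span_add) (simp add: algebra_simps)

lift_definition minus_cohit :: "cohit \<Rightarrow> cohit \<Rightarrow> cohit" is "(-)"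
  unfolding hit_def by (drule (1) P5.span_diff) (simp add: algebra_simps)

lift_definition uminus_cohit :: "cohit \<Rightarrow> cohit" is uminus
  unfolding hit_def by (drule P5.span_neg) (simp add: algebra_simps)

instance
  by standard (transfer; simp add: hit_def P5.span_zero algebra_simps)+

end

lemma abs_cohit_eq_0_iff: "abs_cohit f = 0 \<longleftrightarrow> f \<in> hit"
  by (simp add: zero_cohit_def cohit.abs_eq_iff)

lemma subst_action_hit: "f \<in> hit \<Longrightarrow> subst_action A f \<in> hit"
  unfolding hit_def
proof (induction rule: P5.span_induct_alt)
  case base
  show ?case by (simp add: P5.span_zero)
next
  case (step c x y)
  from step(1) obtain i g where x: "x = Sq i g" and "i > 0" by blast
  have "subst_action A x = Sq i (subst_action A g)"
    by (simp add: x Sq_subst_action)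
  with \<open>i > 0\<close> have "subst_action A x \<in> P5.span {Sq i f |i f. i > 0}"
    by (auto intro: P5.span_base)
  with step(2) show ?case
    by (simp only: subst_action_simps subst_action_scale P5.span_add P5.span_scale)
qed

lift_definition cohit_action :: "bit ^ 5 ^ 5 \<Rightarrow> cohit \<Rightarrow> cohit" is subst_action
proof -
  fix A :: "bit ^ 5 ^ 5" and f g :: P5
  assume "f - g \<in> hit"
  then have "subst_action A (f - g) \<in> hit"
    by (rule subst_action_hit)
  moreover have "subst_action A f = subst_action A (f - g) + subst_action A g"
    by (simp flip: subst_action_simps(5))
  ultimately show "subst_action A f - subst_action A g \<in> hit"
    by simp
qed

definition cohit_degree :: "nat \<Rightarrow> cohit set" where
  "cohit_degree d = abs_cohit ` {f. homogeneous d f}"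

end

theory Submission
  imports Defs "HOL-Computational_Algebra.Primes"
begin

text \<open>
  Over the field with 32 elements the variables can be replaced by eigenvectors \<open>y\<^sub>i\<close> of a
  Singer cycle, indexed by \<open>i\<close> modulo 5, on which the total square is \<open>y\<^sub>i \<mapsto> y\<^sub>i + y\<^sub>i\<^sub>-\<^sub>1\<^sup>2 t\<close> and a permutation
  of the variables acts by \<open>y\<^sub>i \<mapsto> y\<^sub>i\<^sub>+\<^sub>1\<close>. The Singer cycle and this permutation generate a group of
  odd order 155, so modulo hit elements an invariant class is represented by its average, a
  combination of orbit sums of the nine cyclic classes of monomials \<open>y\<^sup>a\<close> of degree 11 with
  \<open>\<Sum>\<^sub>i 2\<^sup>i a\<^sub>i\<close> divisible by 31. Seven explicit hit elements reduce these nine to two.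

  The coefficient at a spike such as \<open>x\<^sub>c\<^sup>7 x\<^sub>a\<^sup>3 x\<^sub>b\<close> vanishes on hit elements. Under \<open>x\<^sub>a \<mapsto> x\<^sub>a + x\<^sub>c\<close>
  it changes by the coefficient at \<open>x\<^sub>c\<^sup>3 x\<^sub>a\<^sup>7 x\<^sub>b\<close>, so it vanishes on every invariant class. Two such
  coefficients, taken after a change of variables, separate the two remaining orbit sums.
\<close>


section \<open>The field with 32 elements\<close>

definition K_modulus :: "bit poly" where
  "K_modulus = [:1, 1, 1, 0, 1, 1:]"

quotient_type K = "bit poly" / "\<lambda>p q. p mod K_modulus = q mod K_modulus"
  by (auto intro!: equivpI reflpI sympI transpI)

instantiation K :: comm_ring_1
begin

lift_definition zero_K :: K is 0 .

lift_definition one_K :: K is 1 .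

lift_definition plus_K :: "K \<Rightarrow> K \<Rightarrow> K" is "(+)"
  by (rule mod_add_cong)

lift_definition minus_K :: "K \<Rightarrow> K \<Rightarrow> K" is "(-)"
  by (rule mod_diff_cong)

lift_definition uminus_K :: "K \<Rightarrow> K" is uminus
  by (rule mod_minus_cong)

lift_definition times_K :: "K \<Rightarrow> K \<Rightarrow> K" is "(*)"
  by (rule mod_mult_cong)

instance
proof
  fix a b c :: K
  show "a * b * c = a * (b * c)"
    by transfer (simp only: mult.assoc)
  show "a * b = b * a"
    by transfer (simp only: mult.commute)
  show "1 * a = a"
    by transfer (simp only: mult_1_left)
  show "a + b + c = a + (b + c)"
    by transfer (simp only: add.assoc)
  show "a + b = b + a"
    by transfer (simp only: add.commute)
  show "0 + a = a"
    by transfer (simp only: add_0_left)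
  show "- a + a = 0"
    by transfer (simp only: left_minus)
  show "a - b = a + - b"
    by transfer (simp only: diff_conv_add_uminus)
  show "(a + b) * c = a * c + b * c"
    by transfer (simp only: distrib_right)
  have "degree (1 :: bit poly) < degree K_modulus"
    by (simp add: K_modulus_def)
  then have "1 mod K_modulus = 1"
    by (rule mod_poly_less)
  then show "(0 :: K) \<noteq> 1"
    by transfer simp
qed

end

definition gen :: K where
  "gen = abs_K [:0, 1:]"

definition K_of_bit :: "bit \<Rightarrow> K" where
  "K_of_bit b = abs_K [:b:]"

lift_definition bit_of_K :: "K \<Rightarrow> bit" is "\<lambda>p. poly.coeff (p mod K_modulus) 0"
  by simp

lemma K_of_bit_simps [simp]:
  "K_of_bit 0 = 0" "K_of_bit 1 = 1" "K_of_bit (a + b) = K_of_bit a + K_of_bit b"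
  by (simp_all only: K_of_bit_def zero_K_def one_K_def one_pCons plus_K.abs_eq add_pCons pCons_0_0
      add_0_left)

lemma bit_of_K_0 [simp]: "bit_of_K 0 = 0"
  by transfer simp

lemma bit_of_K_add: "bit_of_K (x + y) = bit_of_K x + bit_of_K y"
  by transfer (simp add: poly_mod_add_left)

lemma bit_of_K_of_bit [simp]: "bit_of_K (K_of_bit b) = b"
  by (simp add: K_of_bit_def bit_of_K.abs_eq K_modulus_def mod_poly_less)

lemma K_add_self [simp]: "x + x = (0 :: K)" "x + (x + y) = (y :: K)"
proof -
  show *: "x + x = 0" for x :: K
  proof transfer
    fix p :: "bit poly"
    have "p + p = 0"
      by (rule poly_eqI) (simp only: coeff_add, simp)
    then show "(p + p) mod K_modulus = 0 mod K_modulus"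
      by (simp only:)
  qed
  show "x + (x + y) = y"
    by (simp add: * flip: add.assoc)
qed

lemma K_two [simp]: "(2 :: K) = 0"
  using K_add_self(1)[of 1] by (simp only: one_add_one)

lemma K_uminus [simp]: "- x = (x :: K)"
  by (metis K_add_self(1) minus_unique)

lemma gen_5: "gen ^ 5 = gen ^ 4 + gen ^ 2 + gen + 1"
proof -
  let ?X = "[:0, 1:] :: bit poly"
  have pow: "gen ^ n = abs_K (?X ^ n)" for n
    by (induction n) (simp_all add: gen_def one_K_def times_K.abs_eq)
  have "?X ^ 5 - (?X ^ 4 + ?X ^ 2 + ?X + 1) = K_modulus"
    by (simp add: K_modulus_def numeral_eq_Suc one_pCons)
  then have "abs_K (?X ^ 5) = abs_K (?X ^ 4 + ?X ^ 2 + ?X + 1)"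
    by (simp only: K.abs_eq_iff mod_eq_dvd_iff dvd_refl)
  then show ?thesis
    by (simp only: pow flip: plus_K.abs_eq one_K_def) (simp only: gen_def)
qed

lemma K_square_add: "(x + y)\<^sup>2 = x\<^sup>2 + (y :: K)\<^sup>2"
  by (simp add: power2_sum)

lemma gen_powers:
  "gen ^ 6 = gen ^ 4 + gen ^ 3 + 1"
  "gen ^ 8 = gen ^ 3 + gen"
  "gen ^ 16 = gen ^ 4 + gen ^ 3 + gen ^ 2 + 1"
  "gen ^ 32 = gen"
proof -
  have Suc: "gen ^ 6 = gen * gen ^ 5" "gen ^ 7 = gen * gen ^ 6" "gen ^ 8 = gen * gen ^ 7"
      "gen * gen = gen ^ 2" "gen * gen ^ 2 = gen ^ 3" "gen * gen ^ 3 = gen ^ 4" "gen * gen ^ 4 = gen ^ 5"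
    by (simp_all add: numeral_eq_Suc)
  have sq: "gen ^ 16 = (gen ^ 8)\<^sup>2" "gen ^ 32 = (gen ^ 16)\<^sup>2"
      "(gen ^ 4)\<^sup>2 = gen ^ 8" "(gen ^ 3)\<^sup>2 = gen ^ 6" "(gen\<^sup>2)\<^sup>2 = gen ^ 4"
    by (simp_all flip: power_mult)
  have cancel: "x + (y + (x + z)) = y + z" for x y z :: K
    by (metis K_add_self(2) add.left_commute)
  show 6: "gen ^ 6 = gen ^ 4 + gen ^ 3 + 1"
    unfolding Suc(1) gen_5 by (simp only: distrib_left Suc(4-) gen_5 mult_1_right) (simp add: add_ac)
  have 7: "gen ^ 7 = gen ^ 2 + 1"
    unfolding Suc(2) 6 by (simp only: distrib_left Suc(4-) gen_5 mult_1_right) (simp add: add_ac)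
  show 8: "gen ^ 8 = gen ^ 3 + gen"
    unfolding Suc(3) 7 by (simp only: distrib_left Suc(4-) mult_1_right)
  show 16: "gen ^ 16 = gen ^ 4 + gen ^ 3 + gen ^ 2 + 1"
    unfolding sq(1) 8 by (simp only: K_square_add sq(3-) 6) (simp add: add_ac)
  show "gen ^ 32 = gen"
    unfolding sq(2) 16 by (simp only: K_square_add sq(3-) 6 8) (simp add: add_ac)
qed


section \<open>Extension of scalars\<close>

type_synonym P5K = "(5 \<Rightarrow>\<^sub>0 nat) \<Rightarrow>\<^sub>0 K"

definition Const :: "K \<Rightarrow> P5K" where
  "Const c = Poly_Mapping.single 0 c"

definition varK :: "5 \<Rightarrow> P5K" where
  "varK j = Poly_Mapping.single (Poly_Mapping.single j 1) 1"

lemma Const_simps [simp]: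
  "Const 0 = 0" "Const 1 = 1"
  by (simp_all add: Const_def)

lemma Const_add: "Const (a + b) = Const a + Const b"
  by (simp only: Const_def single_add)

lemma Const_mult: "Const (a * b) = Const a * Const b"
  by (simp add: Const_def mult_single)

lemma Const_sum: "Const (\<Sum>i\<in>I. f i) = (\<Sum>i\<in>I. Const (f i))"
  by (induction I rule: infinite_finite_induct)
    (simp_all only: Const_simps Const_add sum.infinite sum.empty sum.insert not_False_eq_True)

lemma Const_power: "Const (a ^ n) = Const a ^ n"
  by (induction n) (simp_all add: Const_mult)

lemma lookup_Const_mult: "Poly_Mapping.lookup (Const c * f) m = c * Poly_Mapping.lookup f m"
proof -
  have "Const c * f = Poly_Mapping.map ((*) c) f"
    by (simp add: Const_def mult_map_scale_conv_mult)
  then show ?thesis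
    by (simp add: map.rep_eq when_def)
qed

lemma P5K_add_self [simp]: "f + f = (0 :: P5K)" "f + (f + g) = (g :: P5K)"
proof -
  show *: "f + f = 0" for f :: P5K
    by (rule poly_mapping_eqI) (simp only: lookup_add K_add_self lookup_zero)
  show "f + (f + g) = g"
    by (simp add: * flip: add.assoc)
qed

lemma P5K_two [simp]: "(2 :: P5K) = 0"
  using P5K_add_self(1)[of 1] by (simp only: one_add_one)

lemma P5K_square_add: "(f + g)\<^sup>2 = f\<^sup>2 + (g :: P5K)\<^sup>2"
  by (simp add: power2_sum)

lemma P5K_square_sum: "(\<Sum>i\<in>I. f i)\<^sup>2 = (\<Sum>i\<in>I. (f i :: P5K)\<^sup>2)"
  by (induction I rule: infinite_finite_induct) (simp_all add: P5K_square_add)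

lemma varK_power: "varK j ^ k = Poly_Mapping.single (Poly_Mapping.single j k) 1"
  by (induction k) (simp_all add: varK_def mult_single flip: single_add)

lemma prod_single_one_K:
  "finite A \<Longrightarrow> (\<Prod>j\<in>A. Poly_Mapping.single (g j) 1) = (Poly_Mapping.single (\<Sum>j\<in>A. g j) 1 :: P5K)"
  by (induction A rule: finite_induct) (simp_all add: mult_single)

lemma sum_single_lookup:
  "(\<Sum>j\<in>UNIV. Poly_Mapping.single j (Poly_Mapping.lookup m j)) = (m :: 5 \<Rightarrow>\<^sub>0 nat)"
  by (rule poly_mapping_eqI) (simp add: lookup_sum lookup_single when_def)

lemma single_eq_Const_mult:
  "(Poly_Mapping.single m c :: P5K) = Const c * (\<Prod>j\<in>UNIV. varK j ^ Poly_Mapping.lookup m j)"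
  by (simp add: varK_power prod_single_one_K sum_single_lookup Const_def mult_single)

lemma P5K_induct_single [case_names zero single add]:
  fixes f :: P5K
  assumes zero: "P 0" and single: "\<And>m c. P (Poly_Mapping.single m c)"
    and add: "\<And>f g. P f \<Longrightarrow> P g \<Longrightarrow> P (f + g)"
  shows "P f"
proof -
  have sum: "P (\<Sum>m\<in>A. h m)" if "finite A" "\<And>m. P (h m)" for A and h :: "(5 \<Rightarrow>\<^sub>0 nat) \<Rightarrow> P5K"
    using that(1) by (induction A rule: finite_induct) (auto intro: zero add that(2))
  have "f = (\<Sum>m\<in>Poly_Mapping.keys f. Poly_Mapping.single m (Poly_Mapping.lookup f m))"
    by (rule poly_mapping_eqI) (auto simp: lookup_sum lookup_single when_def in_keys_iff)
  with sum[of "Poly_Mapping.keys f"] single show ?thesis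
    by (metis finite_keys)
qed

lemma P5K_induct [case_names const var add mult]:
  fixes f :: P5K
  assumes const: "\<And>c. P (Const c)" and var: "\<And>j. P (varK j)"
    and add: "\<And>f g. P f \<Longrightarrow> P g \<Longrightarrow> P (f + g)"
    and mult: "\<And>f g. P f \<Longrightarrow> P g \<Longrightarrow> P (f * g)"
  shows "P f"
proof (induction f rule: P5K_induct_single)
  case zero
  show ?case using const[of 0] by simp
next
  case (single m c)
  have one: "P 1" using const[of 1] by simp
  have pow: "P (f ^ k)" if "P f" for f k
    by (induction k) (auto intro: one mult that)
  have prod: "P (\<Prod>j\<in>A. h j)" if "finite A" "\<And>j. P (h j)" for A and h :: "5 \<Rightarrow> P5K"
    using that(1) by (induction A rule: finite_induct) (auto intro: one mult that(2))
  show ?case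
    by (auto simp: single_eq_Const_mult intro!: mult const prod pow var)
qed (rule add)

definition reval :: "(K \<Rightarrow> 'r) \<Rightarrow> (5 \<Rightarrow> 'r) \<Rightarrow> P5K \<Rightarrow> 'r::comm_ring_1" where
  "reval h g f =
    (\<Sum>m\<in>Poly_Mapping.keys f. h (Poly_Mapping.lookup f m) * (\<Prod>j\<in>UNIV. g j ^ Poly_Mapping.lookup m j))"

locale K_hom =
  fixes h :: "K \<Rightarrow> 'r::comm_ring_1"
  assumes h_zero: "h 0 = 0" and h_one: "h 1 = 1"
    and h_add: "h (a + b) = h a + h b" and h_mult: "h (a * b) = h a * h b"
begin

lemma reval_single:
  "reval h g (Poly_Mapping.single m c) = h c * (\<Prod>j\<in>UNIV. g j ^ Poly_Mapping.lookup m j)"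
  by (cases "c = 0") (simp_all add: reval_def h_zero)

lemma reval_Const: "reval h g (Const c) = h c"
  by (simp add: Const_def reval_single)

lemma reval_zero: "reval h g 0 = 0"
  by (simp add: reval_def)

lemma reval_one: "reval h g 1 = 1"
  using reval_Const[of g 1] by (simp add: h_one)

lemma reval_varK: "reval h g (varK j) = g j"
proof -
  have "(\<Prod>i\<in>UNIV. g i ^ Poly_Mapping.lookup (Poly_Mapping.single j 1) i)
      = (\<Prod>i\<in>UNIV. if i = j then g i else 1)"
    by (rule prod.cong) (auto simp: lookup_single when_def)
  then show ?thesis
    by (simp add: varK_def reval_single h_one)
qed

lemma reval_add: "reval h g (f1 + f2) = reval h g f1 + reval h g f2"
  unfolding reval_def
  by (rule setsum_keys_plus_distrib) (simp_all add: h_zero h_add distrib_right)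

lemma reval_mult: "reval h g (f1 * f2) = reval h g f1 * reval h g f2"
proof (induction f1 rule: P5K_induct_single)
  case (single m c)
  show ?case
    by (induction f2 rule: P5K_induct_single)
      (simp_all add: reval_zero reval_add reval_single mult_single h_mult lookup_add power_add
        prod.distrib algebra_simps)
qed (simp_all add: reval_zero reval_add distrib_right)

lemma reval_sum: "reval h g (\<Sum>i\<in>I. f i) = (\<Sum>i\<in>I. reval h g (f i))"
  by (induction I rule: infinite_finite_induct) (simp_all add: reval_zero reval_add)

lemma reval_power: "reval h g (f ^ n) = reval h g f ^ n"
  by (induction n) (simp_all add: reval_one reval_mult)

lemma reval_prod: "reval h g (\<Prod>i\<in>I. f i) = (\<Prod>i\<in>I. reval h g (f i))"
  by (induction I rule: infinite_finite_induct) (simp_all add: reval_one reval_mult)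

lemmas reval_simps = reval_Const reval_zero reval_one reval_varK reval_add reval_mult reval_sum
  reval_power reval_prod

end

interpretation Const_hom: K_hom Const
  by unfold_locales (simp_all only: Const_simps Const_add Const_mult)

interpretation Const_poly_hom: K_hom "\<lambda>c. [:Const c:]"
proof
  show "[:Const (a + b):] = [:Const a:] + [:Const b:]" for a b
    by (simp add: Const_add)
  show "[:Const (a * b):] = [:Const a:] * [:Const b:]" for a b
    by (simp add: Const_mult)
qed simp_all

definition base_change :: "P5 \<Rightarrow> P5K" where
  "base_change = eval_hom (\<lambda>b. Const (K_of_bit b)) varK"

interpretation K_of_bit_hom: scalar_hom "\<lambda>b. Const (K_of_bit b)"
  by unfold_locales (simp_all only: K_of_bit_simps Const_simps Const_add)

lemma base_change_simps [simp]:
  "base_change 0 = 0" "base_change 1 = 1" "base_change (const b) = Const (K_of_bit b)"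
  "base_change (var j) = varK j"
  "base_change (f + g) = base_change f + base_change g"
  "base_change (f * g) = base_change f * base_change g"
  by (simp_all add: base_change_def K_of_bit_hom.eval_hom_add K_of_bit_hom.eval_hom_mult)

lemma base_change_sum: "base_change (\<Sum>i\<in>I. f i) = (\<Sum>i\<in>I. base_change (f i))"
  by (induction I rule: infinite_finite_induct) simp_all

lemma base_change_power: "base_change (f ^ n) = base_change f ^ n"
  by (induction n) simp_all

lemma base_change_diff: "base_change (f - g) = base_change f + base_change g"
  by (metis P5_uminus base_change_simps(5) diff_conv_add_uminus)

lemma base_change_single:
  "base_change (Poly_Mapping.single m c) = Poly_Mapping.single m (K_of_bit c)"
  by (simp add: base_change_def K_of_bit_hom.eval_hom_single single_eq_Const_mult)

lemma P5_expand: "(f :: P5) = (\<Sum>m\<in>Poly_Mapping.keys f. Poly_Mapping.single m (Poly_Mapping.lookup f m))"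
  by (rule poly_mapping_eqI)
    (auto simp: lookup_sum lookup_single when_def in_keys_iff simp del: bit_not_zero_iff)

lemma lookup_base_change:
  "Poly_Mapping.lookup (base_change f) m = K_of_bit (Poly_Mapping.lookup f m)"
proof -
  have "base_change f = (\<Sum>m\<in>Poly_Mapping.keys f. Poly_Mapping.single m (K_of_bit (Poly_Mapping.lookup f m)))"
    by (subst P5_expand) (simp only: base_change_sum base_change_single)
  then show ?thesis
    by (auto simp: lookup_sum lookup_single when_def in_keys_iff simp del: bit_not_zero_iff)
qed

definition descend :: "P5K \<Rightarrow> P5" where
  "descend = Poly_Mapping.map bit_of_K"

lemma lookup_descend: "Poly_Mapping.lookup (descend f) m = bit_of_K (Poly_Mapping.lookup f m)"
  by (simp add: descend_def map.rep_eq when_def)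

lemma descend_zero [simp]: "descend 0 = 0"
  by (rule poly_mapping_eqI) (simp add: lookup_descend)

lemma descend_add: "descend (f + g) = descend f + descend g"
  by (rule poly_mapping_eqI) (simp only: lookup_descend lookup_add bit_of_K_add)

lemma descend_base_change [simp]: "descend (base_change f) = f"
  by (rule poly_mapping_eqI) (simp add: lookup_descend lookup_base_change)

lemma descend_Const_mult: "descend (Const c * base_change f) = const (bit_of_K c) * f"
proof (rule poly_mapping_eqI)
  fix m
  show "Poly_Mapping.lookup (descend (Const c * base_change f)) m
      = Poly_Mapping.lookup (const (bit_of_K c) * f) m"
    by (cases "Poly_Mapping.lookup f m"; cases "bit_of_K c")
      (simp_all add: lookup_descend lookup_Const_mult lookup_base_change)
qed

subsection \<open>The total square\<close>

definition tot :: "P5K \<Rightarrow> P5K poly" where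
  "tot = reval (\<lambda>c. [:Const c:]) (\<lambda>j. [:varK j, (varK j)\<^sup>2:])"

lemmas tot_simps = Const_poly_hom.reval_simps[where g = "\<lambda>j. [:varK j, (varK j)\<^sup>2:]", folded tot_def]

lemma coeff_tot_base_change: "coeff (tot (base_change f)) n = base_change (Sq n f)"
proof (rule cartan_family_unique
    [where S = "\<lambda>n f. coeff (tot (base_change f)) n" and T = "\<lambda>n f. base_change (Sq n f)"])
  fix n :: nat and j
  consider "n = 0" | "n = 1" | "n \<ge> 2" by linarith
  then show "coeff (tot (base_change (var j))) n = base_change (Sq n (var j))"
  proof cases
    case 1
    then show ?thesis by (simp add: tot_simps Sq_0)
  next
    case 2
    then show ?thesis using Sq_1_var[of j] by (simp add: tot_simps base_change_power)
  next
    case 3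
    then show ?thesis by (auto simp: tot_simps Sq_var_ge2 coeff_pCons split: nat.splits)
  qed
qed (simp_all add: tot_simps Sq_add Sq_mult Sq_0 coeff_mult base_change_sum)

lemma coeff_tot_Const_mult: "coeff (tot (Const c * f)) n = Const c * coeff (tot f) n"
  by (simp add: tot_simps)

lemma descend_coeff_tot: "descend (coeff (tot f) n) = Sq n (descend f)"
proof (induction f rule: P5K_induct_single)
  case (single m c)
  have "Poly_Mapping.single m c = Const c * base_change (Poly_Mapping.single m 1)"
    by (simp add: base_change_single Const_def mult_single)
  then show ?case
    by (simp add: coeff_tot_Const_mult coeff_tot_base_change descend_Const_mult Sq_const_mult)
qed (simp_all add: tot_simps descend_add Sq_add)

inductive_set hitK :: "P5K set" where
  coeff_tot: "n > 0 \<Longrightarrow> coeff (tot f) n \<in> hitK"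
| zero: "0 \<in> hitK"
| add: "f \<in> hitK \<Longrightarrow> g \<in> hitK \<Longrightarrow> f + g \<in> hitK"

lemma hitK_Const_mult: "f \<in> hitK \<Longrightarrow> Const c * f \<in> hitK"
  by (induction rule: hitK.induct)
    (auto simp: distrib_left intro: hitK.intros simp flip: coeff_tot_Const_mult)

lemma hitK_sum: "(\<And>i. i \<in> I \<Longrightarrow> f i \<in> hitK) \<Longrightarrow> (\<Sum>i\<in>I. f i) \<in> hitK"
  by (induction I rule: infinite_finite_induct) (auto intro: hitK.intros)

lemma descend_hitK: "f \<in> hitK \<Longrightarrow> descend f \<in> hit"
proof (induction rule: hitK.induct)
  case (coeff_tot n f)
  then show ?case
    unfolding hit_def by (auto simp: descend_coeff_tot intro!: P5.span_base)
qed (simp_all add: hit_def P5.span_zero descend_add P5.span_add)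

lemma base_change_hit_iff: "base_change f \<in> hitK \<longleftrightarrow> f \<in> hit"
proof
  assume "base_change f \<in> hitK"
  then show "f \<in> hit"
    using descend_hitK by fastforce
next
  assume "f \<in> hit"
  then show "base_change f \<in> hitK"
    unfolding hit_def
  proof (induction rule: P5.span_induct_alt)
    case (step c x y)
    from step(1) obtain i g where x: "x = Sq i g" and "i > 0" by blast
    then have "base_change x \<in> hitK"
      by (auto simp flip: coeff_tot_base_change intro: hitK.coeff_tot)
    with step(2) show ?case
      by (simp add: P5_scale_def hitK.add hitK_Const_mult)
  qed (simp add: hitK.zero)
qed

definition substK :: "bit ^ 5 ^ 5 \<Rightarrow> P5K \<Rightarrow> P5K" where
  "substK A = reval Const (\<lambda>j. \<Sum>i\<in>UNIV. Const (K_of_bit (A $ i $ j)) * varK i)"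

lemmas substK_simps =
  Const_hom.reval_simps[where g = "\<lambda>j. \<Sum>i\<in>UNIV. Const (K_of_bit (A $ i $ j)) * varK i",
    folded substK_def] for A

lemma substK_base_change: "substK A (base_change f) = base_change (subst_action A f)"
  by (induction f rule: P5_induct) (simp_all add: substK_simps base_change_sum)

lemma K_of_bit_square: "(K_of_bit b)\<^sup>2 = K_of_bit b"
  by (cases b) simp_all

lemma coeff_tot_substK: "coeff (tot (substK A f)) n = substK A (coeff (tot f) n)"
proof (induction f arbitrary: n rule: P5K_induct)
  case (const c)
  show ?case by (cases n) (simp_all add: substK_simps tot_simps)
next
  case (var j)
  consider "n = 0" | "n = 1" | k where "n = Suc (Suc k)"
    by (metis not0_implies_Suc One_nat_def)
  then show ?case
    by cases (simp_all add: substK_simps tot_simps coeff_sum P5K_square_sum power_mult_distrib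
        K_of_bit_square mult.commute flip: Const_power)
qed (simp_all add: substK_simps tot_simps coeff_mult)

lemma substK_hitK: "f \<in> hitK \<Longrightarrow> substK A f \<in> hitK"
  by (induction rule: hitK.induct)
    (auto simp: substK_simps intro: hitK.intros simp flip: coeff_tot_substK)


section \<open>Eigenvectors of a Singer cycle\<close>

lemma UNIV_5: "(UNIV :: 5 set) = {0, 1, 2, 3, 4}"
  by (rule sym, rule card_subset_eq) simp_all

lemma exhaust_5: "(i :: 5) = 0 \<or> i = 1 \<or> i = 2 \<or> i = 3 \<or> i = 4"
  using UNIV_5 by blast

lemma forall_5: "(\<forall>i :: 5. P i) \<longleftrightarrow> P 0 \<and> P 1 \<and> P 2 \<and> P 3 \<and> P 4"
  by (metis exhaust_5)

lemma induct_5: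
  fixes i :: 5
  assumes "P 0" "\<And>i :: 5. P i \<Longrightarrow> P (i + 1)"
  shows "P i"
proof -
  have "P 1" using assms(2)[of 0] assms(1) by simp
  moreover from this have "P 2" using assms(2)[of 1] by simp
  moreover from this have "P 3" using assms(2)[of 2] by simp
  moreover from this have "P 4" using assms(2)[of 3] by simp
  ultimately show ?thesis
    using assms(1) exhaust_5[of i] by metis
qed

lemma sum_5: "(\<Sum>i\<in>UNIV. f (i :: 5)) = f 0 + (f 1 + (f 2 + (f 3 + f 4)))"
  unfolding UNIV_5 by simp

lemma prod_5: "(\<Prod>i\<in>UNIV. f (i :: 5)) = f 0 * (f 1 * (f 2 * (f 3 * f 4)))"
  unfolding UNIV_5 by simp

lemma sum_shift_5:
  fixes i :: 5
  shows "(\<Sum>j\<in>UNIV. f (i + j)) = (\<Sum>j\<in>UNIV. f j)" "(\<Sum>j\<in>UNIV. f (j + i)) = (\<Sum>j\<in>UNIV. f j)"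
proof -
  show *: "(\<Sum>j\<in>UNIV. f (i + j)) = (\<Sum>j\<in>UNIV. f j)"
    by (rule sum.reindex_bij_witness[of _ "\<lambda>j. j - i" "\<lambda>j. i + j"]) auto
  then show "(\<Sum>j\<in>UNIV. f (j + i)) = (\<Sum>j\<in>UNIV. f j)"
    by (simp add: add.commute)
qed

text \<open>The conjugates of \<open>gen\<close>, which form a self-dual normal basis; \<open>singer\<close> below is the matrix of
  multiplication by \<open>gen\<close> in this basis.\<close>

definition conj_gen :: "5 \<Rightarrow> K" where
  "conj_gen i = (if i = 0 then gen else if i = 1 then gen ^ 2 else if i = 2 then gen ^ 4
    else if i = 3 then gen ^ 8 else gen ^ 16)"

lemma conj_gen_square: "(conj_gen i)\<^sup>2 = conj_gen (i + 1)"
  using exhaust_5[of i] by (auto simp: conj_gen_def gen_powers(4) simp flip: power_mult)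

lemma conj_gen_mult:
  "conj_gen i * conj_gen i = conj_gen (i + 1)"
  "conj_gen i * conj_gen (i + 1) = conj_gen i + conj_gen (i + 3)"
  "conj_gen i * conj_gen (i + 2) = conj_gen (i + 3) + conj_gen (i + 4)"
  "conj_gen i * conj_gen (i + 3) = conj_gen (i + 1) + conj_gen (i + 2)"
  "conj_gen i * conj_gen (i + 4) = conj_gen (i + 2) + conj_gen (i + 4)"
proof -
  have mult: "gen * gen ^ 2 = gen ^ 3" "gen * gen ^ 3 = gen ^ 4" "gen * gen ^ 4 = gen ^ 5"
    by (simp_all add: numeral_eq_Suc)
  show "conj_gen i * conj_gen i = conj_gen (i + 1)"
    using conj_gen_square[of i] by (simp add: power2_eq_square)
  have base: "conj_gen 0 * conj_gen 1 = conj_gen 0 + conj_gen 3" "conj_gen 0 * conj_gen 2 = conj_gen 3 + conj_gen 4" "conj_gen 0 * conj_gen 3 = conj_gen 1 + conj_gen 2"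
      "conj_gen 0 * conj_gen 4 = conj_gen 2 + conj_gen 4"
    by (simp_all add: conj_gen_def gen_powers gen_5 mult distrib_left mult power2_eq_square[symmetric]
        add_ac)
  have step: "conj_gen (i + 1) * conj_gen (i + 1 + k) = conj_gen (i + 1 + a) + conj_gen (i + 1 + b)"
    if "conj_gen i * conj_gen (i + k) = conj_gen (i + a) + conj_gen (i + b)" for i k a b
  proof -
    have "(conj_gen i)\<^sup>2 * (conj_gen (i + k))\<^sup>2 = (conj_gen (i + a))\<^sup>2 + (conj_gen (i + b))\<^sup>2"
      by (metis that power_mult_distrib K_square_add)
    then show ?thesis
      by (simp only: conj_gen_square add.assoc add.commute[of 1])
  qed
  have *: "conj_gen i * conj_gen (i + k) = conj_gen (i + a) + conj_gen (i + b)" if "conj_gen 0 * conj_gen k = conj_gen a + conj_gen b" for k a b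
    by (rule induct_5[of "\<lambda>i. conj_gen i * conj_gen (i + k) = conj_gen (i + a) + conj_gen (i + b)"]) (simp add: that, rule step)
  show "conj_gen i * conj_gen (i + 1) = conj_gen i + conj_gen (i + 3)" "conj_gen i * conj_gen (i + 2) = conj_gen (i + 3) + conj_gen (i + 4)"
      "conj_gen i * conj_gen (i + 3) = conj_gen (i + 1) + conj_gen (i + 2)" "conj_gen i * conj_gen (i + 4) = conj_gen (i + 2) + conj_gen (i + 4)"
    using *[OF base(2)] *[OF base(3)] *[OF base(4)] *[of 1 0 3] base(1) by simp_all
qed

lemma conj_gen_trace: "(\<Sum>i\<in>UNIV. conj_gen i) = 1"
  by (simp add: sum_5) (simp add: conj_gen_def gen_powers add_ac)

lemma conj_gen_orthonormal: "(\<Sum>i\<in>UNIV. conj_gen i * conj_gen (i + k)) = (if k = 0 then 1 else 0)"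
proof -
  have tr: "(\<Sum>i\<in>UNIV. conj_gen (i + j)) = 1" for j
    by (simp add: sum_shift_5 conj_gen_trace)
  show ?thesis
    using exhaust_5[of k] by (auto simp: conj_gen_mult sum.distrib tr conj_gen_trace)
qed

definition eig :: "5 \<Rightarrow> P5K" where
  "eig i = (\<Sum>j\<in>UNIV. Const (conj_gen (i + j)) * varK j)"

lemma varK_eq_sum_eig: "varK j = (\<Sum>i\<in>UNIV. Const (conj_gen (i + j)) * eig i)"
proof -
  have "(\<Sum>i\<in>UNIV. Const (conj_gen (i + j)) * eig i)
      = (\<Sum>k\<in>UNIV. Const (\<Sum>i\<in>UNIV. conj_gen (i + j) * conj_gen (i + k)) * varK k)"
    unfolding eig_def sum_distrib_left sum_distrib_right Const_sum
    by (subst sum.swap) (simp add: Const_mult mult.assoc)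
  moreover have "(\<Sum>i\<in>UNIV. conj_gen (i + j) * conj_gen (i + k)) = (if k = j then 1 else 0)" for k
    using sum_shift_5(2)[of "\<lambda>i. conj_gen i * conj_gen (i + (k - j))" j] conj_gen_orthonormal[of "k - j"]
    by (simp add: algebra_simps)
  ultimately show ?thesis
    by (simp add: if_distrib[of Const] if_distrib[of "\<lambda>a. a * b" for b] cong: if_cong)
qed

lemma tot_eig: "tot (eig i) = [:eig i, (eig (i - 1))\<^sup>2:]"
proof -
  have "(eig (i - 1))\<^sup>2 = (\<Sum>j\<in>UNIV. Const (conj_gen (i + j)) * (varK j)\<^sup>2)"
    by (simp add: eig_def P5K_square_sum power_mult_distrib conj_gen_square flip: Const_power)
  moreover have "(\<Sum>j\<in>UNIV. [:f j, g j:]) = [:\<Sum>j\<in>UNIV. f j, \<Sum>j\<in>UNIV. g j:]" for f g :: "5 \<Rightarrow> P5K"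
    by (simp add: sum_5)
  ultimately show ?thesis
    by (simp add: eig_def tot_simps mult.commute)
qed

definition singer :: "bit ^ 5 ^ 5" where
  "singer = (\<chi> i j. if (i, j) \<in> {(1, 0), (0, 1), (3, 1), (3, 2), (4, 2), (1, 3), (2, 3), (2, 4), (4, 4)}
    then 1 else 0)"

definition rotation :: "bit ^ 5 ^ 5" where
  "rotation = (\<chi> i j. if j = i + 1 then 1 else 0)"

lemma substK_singer_eig: "substK singer (eig i) = Const (conj_gen i) * eig i"
proof -
  have "substK singer (eig i) = (\<Sum>k\<in>UNIV. Const (conj_gen i * conj_gen (i + k)) * varK k)"
    by (simp add: eig_def substK_simps sum_5 singer_def conj_gen_mult Const_add)
      (simp add: distrib_left distrib_right add_ac)
  then show ?thesis
    by (simp add: eig_def sum_distrib_left Const_mult mult.assoc)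
qed

lemma substK_rotation_eig: "substK rotation (eig i) = eig (i + 1)"
proof -
  have "substK rotation (varK j) = varK (j - 1)" for j
    using exhaust_5[of j] by (auto simp: substK_simps rotation_def sum_5)
  then have "substK rotation (eig i) = (\<Sum>j\<in>UNIV. Const (conj_gen (i + j)) * varK (j - 1))"
    by (simp add: eig_def substK_simps(5-8) substK_simps(1))
  also have "\<dots> = (\<Sum>j\<in>UNIV. Const (conj_gen (i + (j + 1))) * varK (j + 1 - 1))"
    by (rule sum_shift_5(2)[symmetric])
  finally show ?thesis
    by (simp add: eig_def algebra_simps)
qed

lemma GL5_I: "A ** B = mat 1 \<Longrightarrow> A \<in> GL5"
  unfolding GL5_def invertible_def by (auto dest: matrix_left_right_inverse[THEN iffD1])

lemma singer_GL5: "singer \<in> GL5"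
proof (rule GL5_I)
  show "singer ** (\<chi> i j. if (i, j) \<in> {(0, 0), (0, 1), (0, 2), (0, 3), (0, 4), (1, 0), (2, 0), (2, 3),
    (3, 0), (3, 2), (3, 3), (3, 4), (4, 0), (4, 3), (4, 4)} then 1 else 0) = mat 1"
    by (simp add: vec_eq_iff matrix_matrix_mult_def mat_def forall_5 sum_5 singer_def)
qed

lemma rotation_GL5: "rotation \<in> GL5"
proof (rule GL5_I)
  show "rotation ** (\<chi> i j. if i = j + 1 then 1 else 0) = mat 1"
    by (simp add: vec_eq_iff matrix_matrix_mult_def mat_def forall_5 sum_5 rotation_def)
qed


section \<open>Spikes\<close>

lemma P5K_of_nat_even: "even n \<Longrightarrow> of_nat n = (0 :: P5K)"
  by (elim evenE) simp

lemma pCons_power_eq_sum: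
  "[:a, b:] ^ n = (\<Sum>i\<le>n. monom (of_nat (n choose i) * b ^ i * a ^ (n - i)) i)"
  for a b :: "'a :: comm_ring_1"
proof -
  have *: "[:a, b:] = monom b 1 + [:a:]"
    by (simp add: monom_altdef)
  show ?thesis
    unfolding * binomial_ring
    by (rule sum.cong)
      (simp_all add: monom_power poly_const_pow of_nat_poly mult_monom mult_ac flip: monom_0)
qed

lemma prod_monom: "finite A \<Longrightarrow> (\<Prod>j\<in>A. monom (f j) (g j)) = monom (\<Prod>j\<in>A. f j) (\<Sum>j\<in>A. g j :: nat)"
  for f :: "'b \<Rightarrow> 'a :: comm_ring_1"
  by (induction A rule: finite_induct) (simp_all add: mult_monom one_pCons monom_0)

lemma even_choose_spike:
  assumes "m + i \<in> {0, 1, 3, 7}" "i > 0"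
  shows "even (m choose i)"
proof -
  have "m \<in> {0, 1, 2, 3, 4, 5, 6}" "i \<le> 7"
    using assms by auto
  with assms show ?thesis
    by (auto simp: numeral_eq_Suc) presburger+
qed

definition spike :: "(5 \<Rightarrow>\<^sub>0 nat) \<Rightarrow> bool" where
  "spike s \<longleftrightarrow> (\<forall>j. Poly_Mapping.lookup s j \<in> {0, 1, 3, 7})"

lemma lookup_coeff_tot_spike:
  assumes "spike s" "n > 0"
  shows "Poly_Mapping.lookup (coeff (tot f) n) s = 0"
proof (induction f rule: P5K_induct_single)
  case (single m c)
  let ?l = "Poly_Mapping.lookup"
  define T where "T g j = of_nat (?l m j choose g j) * ((varK j)\<^sup>2) ^ g j * varK j ^ (?l m j - g j)"
    for g :: "5 \<Rightarrow> nat" and j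
  have "(\<Prod>j\<in>UNIV. [:varK j, (varK j)\<^sup>2:] ^ ?l m j)
      = (\<Prod>j\<in>UNIV. \<Sum>i\<le>?l m j. monom (of_nat (?l m j choose i) * ((varK j)\<^sup>2) ^ i * varK j ^ (?l m j - i)) i)"
    by (simp only: pCons_power_eq_sum)
  also have "\<dots> = (\<Sum>g\<in>PiE UNIV (\<lambda>j. {..?l m j}). \<Prod>j\<in>UNIV. monom (T g j) (g j))"
    by (simp add: prod_sum_PiE T_def)
  also have "\<dots> = (\<Sum>g\<in>PiE UNIV (\<lambda>j. {..?l m j}). monom (\<Prod>j\<in>UNIV. T g j) (\<Sum>j\<in>UNIV. g j))"
    by (simp add: prod_monom)
  finally have "coeff (tot (Poly_Mapping.single m c)) n
      = (\<Sum>g\<in>PiE UNIV (\<lambda>j. {..?l m j}). if (\<Sum>j\<in>UNIV. g j) = n then Const c * (\<Prod>j\<in>UNIV. T g j) else 0)"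
    unfolding tot_def Const_poly_hom.reval_single
    by (simp add: coeff_sum sum_distrib_left if_distrib cong: if_cong)
  moreover have "?l (\<Prod>j\<in>UNIV. T g j) s = 0"
    if g: "g \<in> PiE UNIV (\<lambda>j. {..?l m j})" and sum: "(\<Sum>j\<in>UNIV. g j) = n" for g
  proof (cases "\<forall>j. ?l m j + g j = ?l s j")
    case True
    from sum \<open>n > 0\<close> obtain j where "g j > 0"
      by (metis gr0I sum.neutral)
    moreover have "?l m j + g j \<in> {0, 1, 3, 7}"
      using True assms(1) by (metis spike_def)
    ultimately have "T g j = 0"
      unfolding T_def by (simp add: P5K_of_nat_even even_choose_spike)
    then have "(\<Prod>j\<in>UNIV. T g j) = 0"
      by (intro prod_zero) auto
    then show ?thesis by simp
  next
    case False
    have "T g j = of_nat (?l m j choose g j) * varK j ^ (?l m j + g j)" for j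
    proof -
      have "g j \<le> ?l m j"
        using g by (auto simp: PiE_def)
      then have "?l m j + g j = 2 * g j + (?l m j - g j)"
        by simp
      then show ?thesis
        by (simp only: T_def power_mult power_add mult.assoc)
    qed
    then have "(\<Prod>j\<in>UNIV. T g j) = Const (of_nat (\<Prod>j\<in>UNIV. ?l m j choose g j))
        * (\<Prod>j\<in>UNIV. varK j ^ (?l m j + g j))"
      by (simp add: prod.distrib Const_def flip: of_nat_prod)
    moreover have "(\<Prod>j\<in>UNIV. varK j ^ (?l m j + g j))
        = Poly_Mapping.single (\<Sum>j\<in>UNIV. Poly_Mapping.single j (?l m j + g j)) 1"
      by (simp add: varK_power prod_single_one_K)
    moreover have "(\<Sum>j\<in>UNIV. Poly_Mapping.single j (?l m j + g j)) \<noteq> s"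
    proof
      assume "(\<Sum>j\<in>UNIV. Poly_Mapping.single j (?l m j + g j)) = s"
      then have "?l s i = (\<Sum>j\<in>UNIV. ?l (Poly_Mapping.single j (?l m j + g j)) i)" for i
        by (metis lookup_sum)
      then have "?l s i = ?l m i + g i" for i
        by (simp add: lookup_single when_def)
      with False show False by simp
    qed
    ultimately show ?thesis
      by (simp add: lookup_Const_mult lookup_single when_def)
  qed
  ultimately show ?case
    by (auto simp: lookup_sum lookup_Const_mult intro!: sum.neutral)
qed (simp_all add: tot_simps lookup_add)

lemma lookup_hitK_spike: "f \<in> hitK \<Longrightarrow> spike s \<Longrightarrow> Poly_Mapping.lookup f s = 0"
  by (induction rule: hitK.induct) (simp_all add: lookup_coeff_tot_spike lookup_add)

definition expo :: "5 \<Rightarrow> 5 \<Rightarrow> 5 \<Rightarrow> nat \<Rightarrow> nat \<Rightarrow> nat \<Rightarrow> 5 \<Rightarrow>\<^sub>0 nat" where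
  "expo c a b p q r = Poly_Mapping.single c p + Poly_Mapping.single a q + Poly_Mapping.single b r"

definition transvection :: "5 \<Rightarrow> 5 \<Rightarrow> bit ^ 5 ^ 5" where
  "transvection c a = (\<chi> i j. if i = j \<or> (i = c \<and> j = a) then 1 else 0)"

lemma transvection_GL5: "c \<noteq> a \<Longrightarrow> transvection c a \<in> GL5"
proof (rule GL5_I)
  assume "c \<noteq> a"
  have "(\<Sum>k\<in>UNIV. transvection c a $ i $ k * transvection c a $ k $ j) = (if i = j then 1 else 0)" for i j
  proof -
    have "(\<Sum>k\<in>UNIV. transvection c a $ i $ k * transvection c a $ k $ j)
        = (\<Sum>k\<in>UNIV. (if k = i then transvection c a $ k $ j else 0)
            + (if k = a then if i = c then transvection c a $ k $ j else 0 else 0))"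
      using \<open>c \<noteq> a\<close> by (intro sum.cong) (auto simp: transvection_def)
    also have "\<dots> = transvection c a $ i $ j + (if i = c then transvection c a $ a $ j else 0)"
      by (simp only: sum.distrib sum.delta finite_class.finite_UNIV UNIV_I if_True)
    finally show ?thesis
      using \<open>c \<noteq> a\<close> by (auto simp: transvection_def)
  qed
  then show "transvection c a ** transvection c a = mat 1"
    by (simp add: vec_eq_iff matrix_matrix_mult_def mat_def)
qed

lemma substK_transvection_varK:
  assumes "c \<noteq> a"
  shows "substK (transvection c a) (varK j) = (if j = a then varK a + varK c else varK j)"
proof -
  have "substK (transvection c a) (varK j)
      = (\<Sum>i\<in>UNIV. (if i = j then varK i else 0) + (if i = c then if j = a then varK i else 0 else 0))"
    unfolding substK_simps using assms by (intro sum.cong) (auto simp: transvection_def)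
  also have "\<dots> = varK j + (if j = a then varK c else 0)"
    by (simp only: sum.distrib sum.delta finite_class.finite_UNIV UNIV_I if_True)
  finally show ?thesis
    by simp
qed

lemma lookup_expo:
  assumes "distinct [c, a, b]"
  shows "Poly_Mapping.lookup (expo c a b p q r) j
    = (if j = c then p else if j = a then q else if j = b then r else 0)"
  using assms by (auto simp: expo_def lookup_add lookup_single when_def)

lemma spike_expo: "distinct [c, a, b] \<Longrightarrow> {p, q, r} \<subseteq> {0, 1, 3, 7} \<Longrightarrow> spike (expo c a b p q r)"
  by (simp add: spike_def lookup_expo)

lemma even_choose_3: "even (n choose 3)" if "n \<in> {4, 5, 6, 8, 9, 10}"
  using that by (auto simp: numeral_eq_Suc) presburger+

lemma odd_choose_3: "odd (n choose 3)" if "n \<in> {3, 7}"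
  using that by (auto simp: numeral_eq_Suc) presburger+

lemma lookup_transvection:
  assumes d: "distinct [c, a, b]"
  shows "Poly_Mapping.lookup (substK (transvection c a) f) (expo c a b 7 3 1)
    = Poly_Mapping.lookup f (expo c a b 7 3 1) + Poly_Mapping.lookup f (expo c a b 3 7 1)"
proof (induction f rule: P5K_induct_single)
  case (single m k)
  let ?l = "Poly_Mapping.lookup" and ?s = "expo c a b 7 3 1" and ?s' = "expo c a b 3 7 1"
  define m' where "m' = m - Poly_Mapping.single a (?l m a)"
  have m': "m = m' + Poly_Mapping.single a (?l m a)" and m'a: "?l m' a = 0"
    by (rule poly_mapping_eqI) (auto simp: m'_def lookup_add lookup_minus lookup_single when_def)
  define e where "e i = m' + Poly_Mapping.single a i + Poly_Mapping.single c (?l m a - i)" for i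
  have e: "(Poly_Mapping.single (e i) k :: P5K) = Poly_Mapping.single m' k * (varK a ^ i * varK c ^ (?l m a - i))"
    for i
    by (simp add: varK_power mult_single e_def add_ac)
  have "(Poly_Mapping.single m k :: P5K) = Poly_Mapping.single m' k * varK a ^ ?l m a"
    using m' by (simp add: varK_power mult_single)
  moreover have "substK (transvection c a) (Poly_Mapping.single m' k) = Poly_Mapping.single m' k"
  proof -
    have "substK (transvection c a) (Poly_Mapping.single m' k)
        = Const k * (\<Prod>j\<in>UNIV. (if j = a then varK a + varK c else varK j) ^ ?l m' j)"
      using d by (simp add: single_eq_Const_mult substK_simps(1-3,5-9) substK_transvection_varK)
    also have "(\<Prod>j\<in>UNIV. (if j = a then varK a + varK c else varK j) ^ ?l m' j) = (\<Prod>j\<in>UNIV. varK j ^ ?l m' j)"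
      by (rule prod.cong) (auto simp: m'a)
    finally show ?thesis
      by (simp add: single_eq_Const_mult)
  qed
  ultimately have "substK (transvection c a) (Poly_Mapping.single m k)
      = Poly_Mapping.single m' k * (varK a + varK c) ^ ?l m a"
    using d by (simp add: substK_simps(6,8) substK_transvection_varK)
  also have "\<dots> = (\<Sum>i\<le>?l m a. of_nat (?l m a choose i) * Poly_Mapping.single (e i) k)"
    unfolding binomial_ring sum_distrib_left
    by (rule sum.cong) (simp_all add: e mult_ac)
  finally have "?l (substK (transvection c a) (Poly_Mapping.single m k)) ?s
      = (\<Sum>i\<le>?l m a. if e i = ?s then of_nat (?l m a choose i) * k else 0)"
    by (simp add: lookup_sum lookup_single when_def if_distrib mult_single flip: single_of_nat cong: if_cong)
  also have "\<dots> = (\<Sum>i\<le>?l m a. if i = 3 then if e 3 = ?s then of_nat (?l m a choose 3) * k else 0 else 0)"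
  proof (rule sum.cong)
    fix i
    have "?l (e i) a = i" "?l ?s a = 3"
      using d by (auto simp: e_def lookup_add lookup_single when_def m'a lookup_expo)
    then show "(if e i = ?s then of_nat (?l m a choose i) * k else 0)
        = (if i = 3 then if e 3 = ?s then of_nat (?l m a choose 3) * k else 0 else 0)"
      by auto
  qed simp
  also have "\<dots> = (if 3 \<le> ?l m a \<and> e 3 = ?s then of_nat (?l m a choose 3) * k else 0)"
    by simp
  also have "\<dots> = (if m = ?s then k else 0) + (if m = ?s' then k else 0)"
  proof -
    have s: "?l ?s a = 3" "?l ?s' a = 7" "?l ?s c = 7" "?l ?s' c = 3"
      using d by (auto simp: lookup_expo)
    have ms: "3 \<le> ?l m a \<and> e 3 = ?s" if "m = ?s"
    proof -
      from that have "?l m a = 3" using s by simp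
      with m' that show ?thesis by (simp add: e_def)
    qed
    have ms': "3 \<le> ?l m a \<and> e 3 = ?s" if "m = ?s'"
    proof -
      from that have 7: "?l m a = 7" using s by simp
      have "?l (e 3) j = ?l ?s j" for j
      proof -
        have "?l m j = ?l m' j + ?l (Poly_Mapping.single a 7) j"
          using m' 7 by (metis lookup_add)
        with that show ?thesis
          using d m'a by (auto simp: e_def 7 lookup_add lookup_single when_def lookup_expo split: if_splits)
      qed
      then show ?thesis using 7 by (simp add: poly_mapping_eqI)
    qed
    show ?thesis
    proof (cases "3 \<le> ?l m a \<and> e 3 = ?s")
      case True
      then have "?l (e 3) c = 7" using s by simp
      then have "?l m a \<le> 10"
        using True d by (simp add: e_def lookup_add lookup_single when_def)
      with True consider "?l m a = 3" | "?l m a = 7" | "?l m a \<in> {4, 5, 6, 8, 9, 10}"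
        by fastforce
      then show ?thesis
      proof cases
        case 1
        then have "m = ?s" using True m' by (simp add: e_def)
        moreover from this have "m \<noteq> ?s'" using s by auto
        ultimately show ?thesis using True 1 by simp
      next
        case 2
        have "?l m j = ?l ?s' j" for j
        proof -
          have "?l m j = ?l m' j + ?l (Poly_Mapping.single a 7) j"
            using m' 2 by (metis lookup_add)
          moreover have "?l (e 3) j = ?l ?s j"
            using True by simp
          ultimately show ?thesis
            using d m'a by (auto simp: e_def 2 lookup_add lookup_single when_def lookup_expo split: if_splits)
        qed
        then have "m = ?s'" by (rule poly_mapping_eqI)
        moreover from this have "m \<noteq> ?s" using s by auto
        moreover have "of_nat (7 choose 3) = (1 :: K)"
          using odd_choose_3[of 7] by (auto elim!: oddE)
        ultimately show ?thesis using True 2 by simp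
      next
        case 3
        then have "m \<noteq> ?s" "m \<noteq> ?s'" using s by auto
        moreover have "of_nat (?l m a choose 3) = (0 :: K)"
          using even_choose_3[OF 3] by (auto elim!: evenE)
        ultimately show ?thesis by simp
      qed
    next
      case False
      with ms ms' show ?thesis by auto
    qed
  qed
  finally show ?case
    by (simp add: lookup_single when_def)
qed (simp_all add: substK_simps lookup_add add_ac)

lemma lookup_invariant:
  assumes d: "distinct [c, a, b]"
    and inv: "\<And>A. A \<in> GL5 \<Longrightarrow> subst_action A f - f \<in> hit"
    and A: "A \<in> GL5"
  shows "Poly_Mapping.lookup (base_change (subst_action A f)) (expo c a b 7 3 1) = 0"
proof -
  have eq: "Poly_Mapping.lookup (base_change (subst_action A f)) s
      = Poly_Mapping.lookup (base_change f) s" if "A \<in> GL5" "spike s" for A s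
  proof -
    have "base_change (subst_action A f) + base_change f \<in> hitK"
      using inv[OF that(1)] by (simp flip: base_change_hit_iff base_change_diff)
    then have "Poly_Mapping.lookup (base_change (subst_action A f)) s
        + Poly_Mapping.lookup (base_change f) s = 0"
      using that(2) by (metis lookup_hitK_spike lookup_add)
    then show ?thesis
      by (metis K_add_self(2) add.commute add_0_left)
  qed
  have zero: "Poly_Mapping.lookup (base_change f) (expo c a b 3 7 1) = 0" if "distinct [c, a, b]" for c a
  proof -
    have "spike (expo c a b 7 3 1)"
      using that by (simp add: spike_expo)
    then show ?thesis
      using lookup_transvection[OF that, of "base_change f"] eq[of "transvection c a"] that
      by (simp add: substK_base_change transvection_GL5)
  qed
  have "expo c a b 7 3 1 = expo a c b 3 7 1"
    by (simp add: expo_def add_ac)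
  with zero[of a c] d have "Poly_Mapping.lookup (base_change f) (expo c a b 7 3 1) = 0"
    by auto
  then show ?thesis
    using d A by (simp add: eq spike_expo)
qed

lemma lookup_varK_power_mult:
  "Poly_Mapping.lookup (varK j ^ k * f) m
    = (if k \<le> Poly_Mapping.lookup m j then Poly_Mapping.lookup f (m - Poly_Mapping.single j k) else 0)"
proof (induction f rule: P5K_induct_single)
  case (single n c)
  have "Poly_Mapping.single j k + n = m
      \<longleftrightarrow> k \<le> Poly_Mapping.lookup m j \<and> n = m - Poly_Mapping.single j k"
  proof
    assume "Poly_Mapping.single j k + n = m"
    then show "k \<le> Poly_Mapping.lookup m j \<and> n = m - Poly_Mapping.single j k"
      by (auto simp: lookup_add)
  next
    assume *: "k \<le> Poly_Mapping.lookup m j \<and> n = m - Poly_Mapping.single j k"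
    show "Poly_Mapping.single j k + n = m"
      by (rule poly_mapping_eqI) (use * in \<open>auto simp: lookup_add lookup_minus lookup_single when_def\<close>)
  qed
  then show ?case
    by (simp add: varK_power mult_single lookup_single when_def)
qed (simp_all add: distrib_left lookup_add)

definition coeff3 :: "5 \<Rightarrow> 5 \<Rightarrow> 5 \<Rightarrow> nat \<Rightarrow> nat \<Rightarrow> nat \<Rightarrow> P5K \<Rightarrow> K" where
  "coeff3 c a b p q r f = Poly_Mapping.lookup f (expo c a b p q r)"

lemma coeff3_varK_power_mult:
  assumes "distinct [c, a, b]"
  shows "coeff3 c a b p q r (varK c ^ k * f) = (if k \<le> p then coeff3 c a b (p - k) q r f else 0)"
    "coeff3 c a b p q r (varK a ^ k * f) = (if k \<le> q then coeff3 c a b p (q - k) r f else 0)"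
    "coeff3 c a b p q r (varK b ^ k * f) = (if k \<le> r then coeff3 c a b p q (r - k) f else 0)"
    "j \<notin> {c, a, b} \<Longrightarrow> k > 0 \<Longrightarrow> coeff3 c a b p q r (varK j ^ k * f) = 0"
proof -
  have sub: "expo c a b p q r - Poly_Mapping.single c k = expo c a b (p - k) q r"
    "expo c a b p q r - Poly_Mapping.single a k = expo c a b p (q - k) r"
    "expo c a b p q r - Poly_Mapping.single b k = expo c a b p q (r - k)"
    using assms by (auto intro!: poly_mapping_eqI simp: lookup_minus lookup_expo lookup_single when_def)
  show "coeff3 c a b p q r (varK c ^ k * f) = (if k \<le> p then coeff3 c a b (p - k) q r f else 0)"
    "coeff3 c a b p q r (varK a ^ k * f) = (if k \<le> q then coeff3 c a b p (q - k) r f else 0)"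
    "coeff3 c a b p q r (varK b ^ k * f) = (if k \<le> r then coeff3 c a b p q (r - k) f else 0)"
    "j \<notin> {c, a, b} \<Longrightarrow> k > 0 \<Longrightarrow> coeff3 c a b p q r (varK j ^ k * f) = 0"
    using assms by (auto simp: coeff3_def lookup_varK_power_mult sub lookup_expo)
qed


section \<open>Pairing with orbit sums\<close>

definition orb :: "nat \<Rightarrow> nat \<Rightarrow> nat \<Rightarrow> nat \<Rightarrow> nat \<Rightarrow> P5K" where
  "orb p q r s t = (\<Sum>i\<in>UNIV. eig i ^ p * eig (i + 1) ^ q * eig (i + 2) ^ r * eig (i + 3) ^ s * eig (i + 4) ^ t)"

lemma coeff3_simps:
  "coeff3 c a b p q r 0 = 0"
  "coeff3 c a b p q r (f + g) = coeff3 c a b p q r f + coeff3 c a b p q r g"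
  "coeff3 c a b p q r (Const k * f) = k * coeff3 c a b p q r f"
  by (simp_all add: coeff3_def lookup_add lookup_Const_mult)

lemma coeff3_sum: "coeff3 c a b p q r (\<Sum>i\<in>I. f i) = (\<Sum>i\<in>I. coeff3 c a b p q r (f i))"
  by (simp add: coeff3_def lookup_sum)

lemma coeff3_one:
  assumes "distinct [c, a, b]"
  shows "coeff3 c a b p q r 1 = (if p = 0 \<and> q = 0 \<and> r = 0 then 1 else 0)"
proof -
  have "expo c a b p q r = 0 \<longleftrightarrow> p = 0 \<and> q = 0 \<and> r = 0"
  proof
    assume "expo c a b p q r = 0"
    then show "p = 0 \<and> q = 0 \<and> r = 0"
      using assms lookup_expo[of c a b p q r c] lookup_expo[of c a b p q r a] lookup_expo[of c a b p q r b]
      by (auto split: if_splits)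
  qed (simp add: expo_def)
  then show ?thesis
    by (simp add: coeff3_def lookup_one when_def)
qed

lemma coeff3_form_mult:
  assumes "distinct [c, a, b]" "k > 0"
  shows "coeff3 c a b p q r ((\<Sum>j\<in>UNIV. Const (l j) * varK j ^ k) * f)
    = (if k \<le> p then l c * coeff3 c a b (p - k) q r f else 0)
      + (if k \<le> q then l a * coeff3 c a b p (q - k) r f else 0)
      + (if k \<le> r then l b * coeff3 c a b p q (r - k) f else 0)"
proof -
  have "coeff3 c a b p q r ((\<Sum>j\<in>UNIV. Const (l j) * varK j ^ k) * f)
      = (\<Sum>j\<in>UNIV. l j * coeff3 c a b p q r (varK j ^ k * f))"
    by (simp add: sum_distrib_right coeff3_sum coeff3_simps mult.assoc)
  also have "\<dots> = (\<Sum>j\<in>{c, a, b}. l j * coeff3 c a b p q r (varK j ^ k * f))"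
    using assms by (intro sum.mono_neutral_right) (auto simp: coeff3_varK_power_mult(4))
  finally show ?thesis
    using assms by (simp add: coeff3_varK_power_mult add.assoc)
qed

lemma coeff3_product:
  fixes l :: "5 \<Rightarrow> 5 \<Rightarrow> K"
  assumes d: "distinct [c, a, b]" and l: "\<And>i. l i c = 1"
    and z: "\<And>i. z i = (\<Sum>j\<in>UNIV. Const (l i j) * varK j)"
  shows "coeff3 c a b 7 3 1 (z u ^ 4 * (z s ^ 2 * (z t ^ 2 * (z m * (z n * z o')))))
    = ((l s a)\<^sup>2 + (l t a)\<^sup>2) * (l m a * (l n b + l o' b) + l n a * (l m b + l o' b) + l o' a * (l m b + l n b))"
proof -
  have z1: "z i = (\<Sum>j\<in>UNIV. Const (l i j) * varK j ^ 1)" for i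
    by (simp add: z)
  have z2: "z i ^ 2 = (\<Sum>j\<in>UNIV. Const ((l i j)\<^sup>2) * varK j ^ 2)" for i
    by (simp add: z P5K_square_sum power_mult_distrib Const_power)
  have "z i ^ 4 = (z i ^ 2)\<^sup>2" for i
    by (simp flip: power_mult)
  then have z4: "z i ^ 4 = (\<Sum>j\<in>UNIV. Const ((l i j) ^ 4) * varK j ^ 4)" for i
    by (simp only: z2 P5K_square_sum power_mult_distrib) (simp flip: power_mult Const_power)
  have co1: "coeff3 c a b p q r (z i * f) = (if 1 \<le> p then l i c * coeff3 c a b (p - 1) q r f else 0)
      + (if 1 \<le> q then l i a * coeff3 c a b p (q - 1) r f else 0)
      + (if 1 \<le> r then l i b * coeff3 c a b p q (r - 1) f else 0)" for i p q r f
    unfolding z1 by (rule coeff3_form_mult[OF d]) simp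
  have co2: "coeff3 c a b p q r (z i ^ 2 * f) = (if 2 \<le> p then (l i c)\<^sup>2 * coeff3 c a b (p - 2) q r f else 0)
      + (if 2 \<le> q then (l i a)\<^sup>2 * coeff3 c a b p (q - 2) r f else 0)
      + (if 2 \<le> r then (l i b)\<^sup>2 * coeff3 c a b p q (r - 2) f else 0)" for i p q r f
    unfolding z2 by (rule coeff3_form_mult[OF d]) simp
  have co4: "coeff3 c a b p q r (z i ^ 4 * f) = (if 4 \<le> p then (l i c) ^ 4 * coeff3 c a b (p - 4) q r f else 0)
      + (if 4 \<le> q then (l i a) ^ 4 * coeff3 c a b p (q - 4) r f else 0)
      + (if 4 \<le> r then (l i b) ^ 4 * coeff3 c a b p q (r - 4) f else 0)" for i p q r f
    unfolding z4 by (rule coeff3_form_mult[OF d]) simp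
  have coeff3_z: "coeff3 c a b p q r (z i) = (if 1 \<le> p then l i c * coeff3 c a b (p - 1) q r 1 else 0)
      + (if 1 \<le> q then l i a * coeff3 c a b p (q - 1) r 1 else 0)
      + (if 1 \<le> r then l i b * coeff3 c a b p q (r - 1) 1 else 0)" for i p q r
    using co1[of p q r i 1] by simp
  show ?thesis
    by (simp add: co1 co2 co4 coeff3_z coeff3_one[OF d] l) (simp add: algebra_simps)
qed

definition shear :: "bit ^ 5 ^ 5" where
  "shear = (\<chi> i j. if i = j \<or> i = 2 then 1 else 0)"

lemma shear_GL5: "shear \<in> GL5"
proof (rule GL5_I)
  show "shear ** shear = mat 1"
    by (simp add: vec_eq_iff matrix_matrix_mult_def mat_def forall_5 sum_5 shear_def)
qed

lemma substK_shear_eig: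
  "substK shear (eig i) = (\<Sum>j\<in>UNIV. Const (if j = 2 then 1 else conj_gen (i + j)) * varK j)"
proof -
  have *: "substK shear (varK j) = (if j = 2 then varK 2 else varK j + varK 2)" for j
    using exhaust_5[of j] by (auto simp: substK_simps sum_5 shear_def add_ac)
  have 1: "conj_gen i + (conj_gen (i + 1) + (conj_gen (i + 2) + (conj_gen (i + 3) + conj_gen (i + 4)))) = 1"
    using sum_shift_5(1)[of conj_gen i] conj_gen_trace by (simp add: sum_5)
  have "substK shear (eig i) = Const (conj_gen i + (conj_gen (i + 1) + (conj_gen (i + 2) + (conj_gen (i + 3) + conj_gen (i + 4))))) * varK 2
      + Const (conj_gen i) * varK 0 + Const (conj_gen (i + 1)) * varK 1 + Const (conj_gen (i + 3)) * varK 3 + Const (conj_gen (i + 4)) * varK 4"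
    by (simp add: eig_def substK_simps(1-3,5-9) * sum_5)
      (simp add: Const_add distrib_left distrib_right add_ac)
  then show ?thesis
    unfolding 1 by (simp add: sum_5 add_ac)
qed

lemma add_table_5:
  "1 + 1 = (2 :: 5)" "1 + 2 = (3 :: 5)" "1 + 3 = (4 :: 5)" "1 + 4 = (0 :: 5)"
  "2 + 1 = (3 :: 5)" "2 + 2 = (4 :: 5)" "2 + 3 = (0 :: 5)" "2 + 4 = (1 :: 5)"
  "3 + 1 = (4 :: 5)" "3 + 2 = (0 :: 5)" "3 + 3 = (1 :: 5)" "3 + 4 = (2 :: 5)"
  "4 + 1 = (0 :: 5)" "4 + 2 = (1 :: 5)" "4 + 3 = (2 :: 5)" "4 + 4 = (3 :: 5)"
  by simp_all

lemmas conj_gen_table = conj_gen_mult conj_gen_mult[of "i + 1", unfolded add.assoc add_table_5 add_0_right]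
  conj_gen_mult[of "i + 2", unfolded add.assoc add_table_5 add_0_right]
  conj_gen_mult[of "i + 3", unfolded add.assoc add_table_5 add_0_right]
  conj_gen_mult[of "i + 4", unfolded add.assoc add_table_5 add_0_right] for i

lemma sum_conj_gen_shift: "(\<Sum>i\<in>UNIV. conj_gen (i + j)) = 1"
  by (simp add: sum_shift_5 conj_gen_trace)

lemma orb_pairing:
  "coeff3 2 0 1 7 3 1 (substK shear (orb 7 2 1 0 1)) = 0"
  "coeff3 2 0 1 7 3 1 (substK shear (orb 5 3 1 2 0)) = 1"
  "coeff3 2 1 0 7 3 1 (substK shear (orb 7 2 1 0 1)) = 1"
  "coeff3 2 1 0 7 3 1 (substK shear (orb 5 3 1 2 0)) = 1"
proof -
  define z where "z i = substK shear (eig i)" for i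
  define l where "l i j = (if j = 2 then 1 else conj_gen (i + j))" for i j
  have z: "z i = (\<Sum>j\<in>UNIV. Const (l i j) * varK j)" and l: "l i 2 = 1" for i
    by (simp_all add: z_def l_def substK_shear_eig)
  have d: "distinct [2, 0, 1 :: 5]" "distinct [2, 1, 0 :: 5]"
    by simp_all
  note coeff3 = coeff3_product[OF d(1), of l z, OF l z] coeff3_product[OF d(2), of l z, OF l z]
  have l01: "l i 0 = conj_gen i" "l i 1 = conj_gen (i + 1)" for i
    by (simp_all add: l_def)
  have A: "p ^ 7 * q\<^sup>2 * r * s = p ^ 4 * (p ^ 2 * (q ^ 2 * (p * (r * s))))" for p q r s :: P5K
    by (simp add: numeral_eq_Suc mult_ac)
  have B: "p ^ 5 * q ^ 3 * r * s ^ 2 = p ^ 4 * (q ^ 2 * (s ^ 2 * (p * (q * r))))" for p q r s :: P5K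
    by (simp add: numeral_eq_Suc mult_ac)
  have orbs: "substK shear (orb 7 2 1 0 1)
      = (\<Sum>i\<in>UNIV. z i ^ 4 * (z i ^ 2 * (z (i + 1) ^ 2 * (z i * (z (i + 2) * z (i + 4))))))"
    "substK shear (orb 5 3 1 2 0)
      = (\<Sum>i\<in>UNIV. z i ^ 4 * (z (i + 1) ^ 2 * (z (i + 3) ^ 2 * (z i * (z (i + 1) * z (i + 2))))))"
    unfolding orb_def substK_simps(5-) z_def[symmetric] by (simp_all only: A B power_one_right power_0 mult_1_right)
  note simps = l01 add.assoc add_table_5 add_0_right power2_eq_square conj_gen_table
    distrib_left distrib_right sum.distrib sum_conj_gen_shift conj_gen_trace K_add_self add_0_left
  show "coeff3 2 0 1 7 3 1 (substK shear (orb 7 2 1 0 1)) = 0"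
    unfolding orbs coeff3_sum coeff3 by (simp only: simps)
  show "coeff3 2 0 1 7 3 1 (substK shear (orb 5 3 1 2 0)) = 1"
    unfolding orbs coeff3_sum coeff3 by (simp only: simps)
  show "coeff3 2 1 0 7 3 1 (substK shear (orb 7 2 1 0 1)) = 1"
    unfolding orbs coeff3_sum coeff3 by (simp only: simps)
  show "coeff3 2 1 0 7 3 1 (substK shear (orb 5 3 1 2 0)) = 1"
    unfolding orbs coeff3_sum coeff3 by (simp only: simps)
qed


section \<open>Hit relations between orbit sums\<close>

lemma orb_rotate: "orb p q r s t = orb t p q r s"
proof -
  have "orb p q r s t = (\<Sum>i\<in>UNIV. eig (i + 1) ^ p * eig (i + 1 + 1) ^ q * eig (i + 1 + 2) ^ r
      * eig (i + 1 + 3) ^ s * eig (i + 1 + 4) ^ t)"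
    unfolding orb_def by (rule sum_shift_5(2)[symmetric])
  then show ?thesis
    unfolding orb_def by (simp only: add.assoc add_table_5 add_0_right) (simp add: mult_ac)
qed

lemma P5K_numeral_Bit [simp]: "(numeral (num.Bit0 n) :: P5K) = 0" "(numeral (num.Bit1 n) :: P5K) = 1"
  by (simp_all only: numeral_Bit0 numeral_Bit1 P5K_add_self add_0_left)

lemma coeff_mult_small:
  "coeff (p * q) 0 = coeff p 0 * coeff q 0"
  "coeff (p * q) 1 = coeff p 0 * coeff q 1 + coeff p 1 * coeff q 0"
  "coeff (p * q) 2 = coeff p 0 * coeff q 2 + coeff p 1 * coeff q 1 + coeff p 2 * coeff q 0"
  "coeff (p * q) 3 = coeff p 0 * coeff q 3 + coeff p 1 * coeff q 2 + coeff p 2 * coeff q 1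
    + coeff p 3 * coeff q 0"
  "coeff (p * q) 4 = coeff p 0 * coeff q 4 + coeff p 1 * coeff q 3 + coeff p 2 * coeff q 2
    + coeff p 3 * coeff q 1 + coeff p 4 * coeff q 0"
  by (simp_all add: coeff_mult numeral_eq_Suc add.assoc)

lemma coeff_linear_power:
  "coeff ([:a, b:] ^ n) k = of_nat (n choose k) * b ^ k * a ^ (n - k)" for a :: "'a :: comm_ring_1"
  by (simp add: pCons_power_eq_sum coeff_sum binomial_eq_0)

lemma choose_numerals:
  "2 choose 2 = 1" "3 choose 2 = 3" "3 choose 3 = 1" "4 choose 2 = 6" "4 choose 3 = 4" "4 choose 4 = 1"
  "5 choose 2 = 10" "5 choose 3 = 10" "5 choose 4 = 5" "7 choose 2 = 21" "7 choose 3 = 35" "7 choose 4 = 35"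
  by (simp_all add: numeral_eq_Suc)

lemma hit_orb:
  assumes "n > 0"
  shows "(\<Sum>i\<in>UNIV. coeff ([:eig i, (eig (i + 4))\<^sup>2:] ^ p * ([:eig (i + 1), (eig i)\<^sup>2:] ^ q
    * ([:eig (i + 2), (eig (i + 1))\<^sup>2:] ^ r * ([:eig (i + 3), (eig (i + 2))\<^sup>2:] ^ s
    * [:eig (i + 4), (eig (i + 3))\<^sup>2:] ^ t)))) n) \<in> hitK"
proof (rule hitK_sum)
  fix i :: 5
  have "i - 1 = i + 4"
    by (simp add: diff_eq_eq add.assoc add_table_5)
  then have "tot (eig i ^ p * (eig (i + 1) ^ q * (eig (i + 2) ^ r * (eig (i + 3) ^ s * eig (i + 4) ^ t))))
    = [:eig i, (eig (i + 4))\<^sup>2:] ^ p * ([:eig (i + 1), (eig i)\<^sup>2:] ^ q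
    * ([:eig (i + 2), (eig (i + 1))\<^sup>2:] ^ r * ([:eig (i + 3), (eig (i + 2))\<^sup>2:] ^ s
    * [:eig (i + 4), (eig (i + 3))\<^sup>2:] ^ t)))"
    by (simp only: tot_simps tot_eig add_diff_eq[symmetric]) simp
  then show "coeff ([:eig i, (eig (i + 4))\<^sup>2:] ^ p * ([:eig (i + 1), (eig i)\<^sup>2:] ^ q
    * ([:eig (i + 2), (eig (i + 1))\<^sup>2:] ^ r * ([:eig (i + 3), (eig (i + 2))\<^sup>2:] ^ s
    * [:eig (i + 4), (eig (i + 3))\<^sup>2:] ^ t)))) n \<in> hitK"
    using assms by (metis hitK.coeff_tot)
qed

lemma hit_relations:
  "orb 7 0 2 2 0 + orb 6 0 2 0 3 \<in> hitK"
  "orb 7 0 2 2 0 + orb 6 0 0 3 2 \<in> hitK"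
  "orb 7 0 2 2 0 + orb 4 1 2 2 2 \<in> hitK"
  "orb 5 3 1 2 0 + orb 5 5 0 0 1 + orb 7 2 1 0 1 + orb 4 3 1 0 3 \<in> hitK"
  "orb 7 0 2 2 0 + orb 6 0 0 3 2 + orb 6 0 2 0 3 + orb 5 0 0 1 5 \<in> hitK"
  "orb 4 1 0 5 1 + orb 4 1 2 2 2 + orb 6 0 0 3 2 + orb 6 0 2 0 3 \<in> hitK"
  "orb 7 0 2 2 0 + orb 6 0 0 3 2 + orb 6 0 2 0 3 + orb 1 2 2 2 4 + orb 5 0 0 1 5 + orb 0 2 0 3 6 + orb 0 2 2 0 7 \<in> hitK"
proof -
  note simps = coeff_mult_small coeff_linear_power choose_numerals binomial_eq_0
  show "orb 7 0 2 2 0 + orb 6 0 2 0 3 \<in> hitK"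
    using hit_orb[of 1 7 0 2 0 1]
    by (simp add: orb_def simps flip: sum.distrib)
      (simp add: algebra_simps numeral_eq_Suc)?
  show "orb 7 0 2 2 0 + orb 6 0 0 3 2 \<in> hitK"
    using hit_orb[of 1 7 0 0 3 0]
    by (simp add: orb_def simps flip: sum.distrib)
      (simp add: algebra_simps numeral_eq_Suc)?
  show "orb 7 0 2 2 0 + orb 4 1 2 2 2 \<in> hitK"
    using hit_orb[of 1 5 1 2 2 0]
    by (simp add: orb_def simps flip: sum.distrib)
      (simp add: algebra_simps numeral_eq_Suc)?
  show "orb 5 3 1 2 0 + orb 5 5 0 0 1 + orb 7 2 1 0 1 + orb 4 3 1 0 3 \<in> hitK"
    using hit_orb[of 1 5 3 1 0 1]
    by (simp add: orb_def simps flip: sum.distrib)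
      (simp add: algebra_simps numeral_eq_Suc)?
  show "orb 7 0 2 2 0 + orb 6 0 0 3 2 + orb 6 0 2 0 3 + orb 5 0 0 1 5 \<in> hitK"
    using hit_orb[of 2 7 0 0 1 1]
    by (simp add: orb_def simps flip: sum.distrib)
      (simp add: algebra_simps numeral_eq_Suc)?
  show "orb 4 1 0 5 1 + orb 4 1 2 2 2 + orb 6 0 0 3 2 + orb 6 0 2 0 3 \<in> hitK"
    using hit_orb[of 2 4 1 0 1 3]
    by (simp add: orb_def simps flip: sum.distrib)
      (simp add: algebra_simps numeral_eq_Suc)?
  show "orb 7 0 2 2 0 + orb 6 0 0 3 2 + orb 6 0 2 0 3 + orb 1 2 2 2 4 + orb 5 0 0 1 5 + orb 0 2 0 3 6 + orb 0 2 2 0 7 \<in> hitK"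
    using hit_orb[of 4 3 2 0 1 1]
    by (simp add: orb_def simps flip: sum.distrib)
      (simp add: algebra_simps numeral_eq_Suc)?
qed

definition generated :: "P5K set" where
  "generated = {f. \<exists>a b. f + (Const a * orb 7 2 1 0 1 + Const b * orb 5 3 1 2 0) \<in> hitK}"

lemma generated_add: "f \<in> generated \<Longrightarrow> g \<in> generated \<Longrightarrow> f + g \<in> generated"
proof -
  assume "f \<in> generated" "g \<in> generated"
  then obtain a b a' b' where
    "f + (Const a * orb 7 2 1 0 1 + Const b * orb 5 3 1 2 0) \<in> hitK"
    "g + (Const a' * orb 7 2 1 0 1 + Const b' * orb 5 3 1 2 0) \<in> hitK"
    by (auto simp: generated_def)
  then have "(f + (Const a * orb 7 2 1 0 1 + Const b * orb 5 3 1 2 0))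
      + (g + (Const a' * orb 7 2 1 0 1 + Const b' * orb 5 3 1 2 0)) \<in> hitK"
    by (rule hitK.add)
  then have "f + g + (Const (a + a') * orb 7 2 1 0 1 + Const (b + b') * orb 5 3 1 2 0) \<in> hitK"
    by (simp add: Const_add algebra_simps)
  then show ?thesis
    by (auto simp: generated_def)
qed

lemma generated_Const_mult: "f \<in> generated \<Longrightarrow> Const c * f \<in> generated"
proof -
  assume "f \<in> generated"
  then obtain a b where "f + (Const a * orb 7 2 1 0 1 + Const b * orb 5 3 1 2 0) \<in> hitK"
    by (auto simp: generated_def)
  then have "Const c * (f + (Const a * orb 7 2 1 0 1 + Const b * orb 5 3 1 2 0)) \<in> hitK"
    by (rule hitK_Const_mult)
  then have "Const c * f + (Const (c * a) * orb 7 2 1 0 1 + Const (c * b) * orb 5 3 1 2 0) \<in> hitK"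
    by (simp add: Const_mult algebra_simps)
  then show ?thesis
    by (auto simp: generated_def)
qed

lemma hitK_generated: "f \<in> hitK \<Longrightarrow> f \<in> generated"
proof -
  assume "f \<in> hitK"
  then have "f + (Const 0 * orb 7 2 1 0 1 + Const 0 * orb 5 3 1 2 0) \<in> hitK"
    by simp
  then show ?thesis
    unfolding generated_def by blast
qed

lemma generated_sum: "(\<And>i. i \<in> I \<Longrightarrow> f i \<in> generated) \<Longrightarrow> (\<Sum>i\<in>I. f i) \<in> generated"
  by (induction I rule: infinite_finite_induct) (auto intro: generated_add hitK_generated hitK.zero)

lemma hitK_cancel: "f + g \<in> hitK \<Longrightarrow> f \<in> hitK \<Longrightarrow> g \<in> hitK"
  using hitK.add[of f "f + g"] by simp

lemma orb_generated:
  "orb 7 0 2 2 0 \<in> generated" "orb 6 0 2 0 3 \<in> generated" "orb 6 0 0 3 2 \<in> generated"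
  "orb 4 1 2 2 2 \<in> generated" "orb 5 5 0 0 1 \<in> generated" "orb 5 1 4 1 0 \<in> generated"
  "orb 7 2 1 0 1 \<in> generated" "orb 5 3 1 2 0 \<in> generated" "orb 4 3 1 0 3 \<in> generated"
proof -
  let ?e = "orb 7 0 2 2 0"
  have rot: "orb 5 0 0 1 5 = orb 5 5 0 0 1" "orb 4 1 0 5 1 = orb 5 1 4 1 0"
    "orb 1 2 2 2 4 = orb 4 1 2 2 2" "orb 0 2 0 3 6 = orb 6 0 2 0 3" "orb 0 2 2 0 7 = ?e"
    using orb_rotate[of 5 0 0 1 5] orb_rotate[of 4 1 0 5 1] orb_rotate[of 1 4 1 0 5]
      orb_rotate[of 1 2 2 2 4] orb_rotate[of 0 2 0 3 6] orb_rotate[of 0 2 2 0 7]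
    by simp_all
  note h = hit_relations[unfolded rot]
  have 5: "?e + orb 5 5 0 0 1 \<in> hitK"
    using hitK.add[OF hitK.add[OF h(1) h(2)] h(5)] by (simp add: add_ac)
  have e: "?e \<in> hitK"
    using hitK.add[OF hitK.add[OF h(3) 5] hitK.add[OF h(7) h(2)]] by (simp add: add_ac)
  have 1: "orb 6 0 2 0 3 \<in> hitK"
    and 2: "orb 6 0 0 3 2 \<in> hitK"
    and 3: "orb 4 1 2 2 2 \<in> hitK"
    and 4: "orb 5 5 0 0 1 \<in> hitK"
    using hitK_cancel[OF h(1) e] hitK_cancel[OF h(2) e] hitK_cancel[OF h(3) e] hitK_cancel[OF 5 e] .
  have 6: "orb 5 1 4 1 0 \<in> hitK"
    using hitK.add[OF h(6) hitK.add[OF 3 hitK.add[OF 2 1]]] by (simp add: add_ac)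
  have "orb 4 3 1 0 3 + (Const 1 * orb 7 2 1 0 1 + Const 1 * orb 5 3 1 2 0) \<in> hitK"
    using hitK.add[OF h(4) 4] by (simp add: add_ac)
  then show "orb 4 3 1 0 3 \<in> generated"
    unfolding generated_def by blast
  have "orb 7 2 1 0 1 + (Const 1 * orb 7 2 1 0 1 + Const 0 * orb 5 3 1 2 0) \<in> hitK"
    "orb 5 3 1 2 0 + (Const 0 * orb 7 2 1 0 1 + Const 1 * orb 5 3 1 2 0) \<in> hitK"
    by (simp_all add: hitK.zero)
  then show "orb 7 2 1 0 1 \<in> generated" "orb 5 3 1 2 0 \<in> generated"
    unfolding generated_def by blast+
  show "?e \<in> generated" "orb 6 0 2 0 3 \<in> generated" "orb 6 0 0 3 2 \<in> generated"
    "orb 4 1 2 2 2 \<in> generated" "orb 5 5 0 0 1 \<in> generated" "orb 5 1 4 1 0 \<in> generated"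
    using e 1 2 3 4 6 by (simp_all add: hitK_generated)
qed

lemma weight_zero_exponents:
  "\<forall>p\<in>set [0..<12]. \<forall>q\<in>set [0..<12 - p]. \<forall>r\<in>set [0..<12 - p - q]. \<forall>s\<in>set [0..<12 - p - q - r].
    31 dvd p + 2 * q + 4 * r + 8 * s + 16 * (11 - p - q - r - s) \<longrightarrow>
    list_ex (\<lambda>k. List.member [[7, 0, 2, 2, 0], [6, 0, 2, 0, 3], [6, 0, 0, 3, 2], [4, 1, 2, 2, 2], [5, 5, 0, 0, 1],
      [5, 1, 4, 1, 0], [7, 2, 1, 0, 1], [5, 3, 1, 2, 0], [4, 3, 1, 0, 3]]
      (rotate k [p, q, r, s, 11 - p - q - r - s])) [0..<5]"
  by code_simp

lemma orb_weight_zero: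
  assumes "p + q + r + s + t = 11" "31 dvd p + 2 * q + 4 * r + 8 * s + 16 * t"
  shows "orb p q r s t \<in> generated"
proof -
  define orbl where "orbl xs = orb (xs ! 0) (xs ! 1) (xs ! 2) (xs ! 3) (xs ! 4)" for xs
  have rot: "orbl (rotate1 xs) = orbl xs" if len: "length xs = 5" for xs
  proof -
    from len obtain a b c d e where "xs = [a, b, c, d, e]"
      by (auto simp: length_Suc_conv numeral_eq_Suc)
    then show ?thesis
      using orb_rotate[of b c d e a] by (simp add: orbl_def numeral_eq_Suc)
  qed
  have rotate: "orbl (rotate k xs) = orbl xs" if "length xs = 5" for k xs
    using that by (induction k) (simp_all add: rot)
  have t: "t = 11 - p - q - r - s"
    using assms by simp
  have "p \<in> set [0..<12]" "q \<in> set [0..<12 - p]" "r \<in> set [0..<12 - p - q]"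
    "s \<in> set [0..<12 - p - q - r]"
    using assms by auto
  then obtain k where "rotate k [p, q, r, s, t] \<in> {[7, 0, 2, 2, 0], [6, 0, 2, 0, 3], [6, 0, 0, 3, 2],
      [4, 1, 2, 2, 2], [5, 5, 0, 0, 1], [5, 1, 4, 1, 0], [7, 2, 1, 0, 1], [5, 3, 1, 2, 0], [4, 3, 1, 0, 3]}"
    using weight_zero_exponents assms(2) unfolding t list_ex_iff by fastforce
  then have "orbl (rotate k [p, q, r, s, t]) \<in> generated"
    by (elim insertE) (simp_all add: orbl_def orb_generated orb_generated[simplified])
  then show ?thesis
    by (simp add: rotate) (simp add: orbl_def)
qed


section \<open>Averaging over the normalizer of the Singer cycle\<close>

lemma gen_power_sum:
  assumes "\<not> 31 dvd e"
  shows "(\<Sum>k<31. (gen ^ e) ^ k) = 0"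
proof -
  have "gen * (gen ^ 4 + gen ^ 3 + gen + 1) = 1"
    using gen_5 by (simp add: numeral_eq_Suc algebra_simps)
  moreover have "gen ^ 31 * gen = gen"
    using gen_powers(4) by (simp flip: power_Suc2)
  ultimately have "gen ^ 31 = 1"
    by (metis mult.assoc mult.right_neutral)
  then have 31: "(gen ^ e) ^ 31 = 1"
    by (metis power_mult mult.commute power_one)
  have "prime (31 :: nat)"
    by code_simp
  then have "gcd e 31 = 1"
    using assms by (metis coprime_commute coprime_imp_gcd_eq_1 prime_imp_coprime)
  moreover have "e \<noteq> 0"
    using assms by (metis dvd_0_right)
  ultimately obtain x k where "e * x = 31 * k + 1"
    using bezout_nat[of e 31] by auto
  then have x: "(gen ^ e) ^ x = gen"
    using \<open>gen ^ 31 = 1\<close> by (simp add: power_mult flip: power_mult[of gen e x])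
  let ?S = "\<Sum>k<31. (gen ^ e) ^ k"
  have "(1 - gen) * ?S = (\<Sum>k<x. (gen ^ e) ^ k) * ((1 - gen ^ e) * ?S)"
    using one_diff_power_eq[of "gen ^ e" x] unfolding x by (simp only: mult_ac)
  also have "(1 - gen ^ e) * ?S = 0"
    unfolding one_diff_power_eq[symmetric] 31 by simp
  finally have "(1 + gen) * ?S = 0"
    by (simp only: diff_conv_add_uminus K_uminus mult_zero_right)
  moreover have "(gen ^ 4 + gen) * (1 + gen) = 1"
    using gen_5 by (simp add: numeral_eq_Suc algebra_simps)
  ultimately show ?thesis
    by (metis mult.assoc mult_zero_right mult_1_left)
qed

definition homK :: "nat \<Rightarrow> P5K \<Rightarrow> bool" where
  "homK d f \<longleftrightarrow> (\<forall>m\<in>Poly_Mapping.keys f. (\<Sum>j\<in>UNIV. Poly_Mapping.lookup m j) = d)"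

lemma homK_add: "homK d f \<Longrightarrow> homK d g \<Longrightarrow> homK d (f + g)"
  unfolding homK_def using keys_add[of f g] by blast

lemma homK_zero: "homK d 0"
  by (simp add: homK_def)

lemma homK_sum: "(\<And>i. i \<in> I \<Longrightarrow> homK d (f i)) \<Longrightarrow> homK d (\<Sum>i\<in>I. f i)"
  by (induction I rule: infinite_finite_induct) (auto intro: homK_add homK_zero)

lemma homK_mult: "homK d f \<Longrightarrow> homK e g \<Longrightarrow> homK (d + e) (f * g)"
  unfolding homK_def using keys_mult[of f g] by (auto simp: lookup_add sum.distrib)

lemma homK_one: "homK 0 1"
  by (simp add: homK_def)

lemma homK_Const: "homK 0 (Const c)"
  by (simp add: homK_def Const_def)

lemma homK_varK: "homK 1 (varK j)"
  by (simp add: homK_def varK_def lookup_single when_def)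

lemma homK_power: "homK d f \<Longrightarrow> homK (d * n) (f ^ n)"
  by (induction n) (auto simp: homK_one intro: homK_mult)

lemma homK_prod:
  "(\<And>i. i \<in> I \<Longrightarrow> homK (d i) (f i)) \<Longrightarrow> homK (\<Sum>i\<in>I. d i) (\<Prod>i\<in>I. f i)"
  by (induction I rule: infinite_finite_induct) (auto simp: homK_one intro: homK_mult)

lemma homK_eig: "homK 1 (eig j)"
  unfolding eig_def using homK_mult[OF homK_Const homK_varK] by (auto intro!: homK_sum)

text \<open>Symmetry and orthonormality of the matrix \<open>conj_gen (i + j)\<close> make the substitution an involution.\<close>

definition to_eig :: "P5K \<Rightarrow> P5K" where
  "to_eig = reval Const eig"

lemmas to_eig_simps = Const_hom.reval_simps[where g = eig, folded to_eig_def]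

lemma to_eig_to_eig: "to_eig (to_eig f) = f"
proof (induction f rule: P5K_induct)
  case (var j)
  have "to_eig (eig j) = varK j"
    unfolding eig_def by (simp add: to_eig_simps) (simp add: varK_eq_sum_eig[of j] add.commute)
  then show ?case
    by (simp add: to_eig_simps)
qed (simp_all add: to_eig_simps)

definition eig_mono :: "5 \<Rightarrow> (5 \<Rightarrow>\<^sub>0 nat) \<Rightarrow> P5K" where
  "eig_mono i m = (\<Prod>j\<in>UNIV. eig (i + j) ^ Poly_Mapping.lookup m j)"

lemma eig_expansion:
  assumes "homogeneous d f"
  obtains g where "homK d g"
    "base_change f = (\<Sum>m\<in>Poly_Mapping.keys g. Const (Poly_Mapping.lookup g m) * eig_mono 0 m)"
proof
  let ?g = "to_eig (base_change f)"
  have "?g = (\<Sum>m\<in>Poly_Mapping.keys f. to_eig (Poly_Mapping.single m (K_of_bit (Poly_Mapping.lookup f m))))"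
    by (subst P5_expand) (simp only: base_change_sum base_change_single to_eig_simps)
  moreover have "homK d (to_eig (Poly_Mapping.single m c))" if "m \<in> Poly_Mapping.keys f" for m c
  proof -
    have "homK (0 + (\<Sum>j\<in>UNIV. 1 * Poly_Mapping.lookup m j)) (to_eig (Poly_Mapping.single m c))"
      unfolding to_eig_def Const_hom.reval_single
      by (intro homK_mult homK_Const homK_prod homK_power homK_eig)
    with assms that show ?thesis
      by (simp add: homogeneous_def)
  qed
  ultimately show "homK d ?g"
    by (simp add: homK_sum)
  have "base_change f = to_eig ?g"
    by (simp add: to_eig_to_eig)
  then show "base_change f
      = (\<Sum>m\<in>Poly_Mapping.keys ?g. Const (Poly_Mapping.lookup ?g m) * eig_mono 0 m)"
    by (simp add: to_eig_def reval_def eig_mono_def)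
qed

definition weight :: "(5 \<Rightarrow>\<^sub>0 nat) \<Rightarrow> nat" where
  "weight m = Poly_Mapping.lookup m 0 + 2 * Poly_Mapping.lookup m 1 + 4 * Poly_Mapping.lookup m 2
    + 8 * Poly_Mapping.lookup m 3 + 16 * Poly_Mapping.lookup m 4"

lemma Const_prod: "Const (\<Prod>i\<in>I. f i) = (\<Prod>i\<in>I. Const (f i))"
  by (induction I rule: infinite_finite_induct) (simp_all add: Const_mult)

lemma substK_singer_eig_mono: "substK singer (eig_mono 0 m) = Const (gen ^ weight m) * eig_mono 0 m"
proof -
  have "gen ^ weight m = (\<Prod>j\<in>UNIV. conj_gen j ^ Poly_Mapping.lookup m j)"
    by (simp add: prod_5 conj_gen_def weight_def power_add power_mult mult.assoc)
  then show ?thesis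
    by (simp add: eig_mono_def substK_simps(1-3,5-9) substK_singer_eig power_mult_distrib prod.distrib
        Const_power Const_prod)
qed

lemma substK_rotation_eig_mono: "substK rotation (eig_mono i m) = eig_mono (i + 1) m"
  by (simp add: eig_mono_def substK_simps(1-3,5-9) substK_rotation_eig add_ac)

lemma sum_eig_mono:
  "(\<Sum>i\<in>UNIV. eig_mono i m) = orb (Poly_Mapping.lookup m 0) (Poly_Mapping.lookup m 1)
    (Poly_Mapping.lookup m 2) (Poly_Mapping.lookup m 3) (Poly_Mapping.lookup m 4)"
  by (simp add: eig_mono_def orb_def prod_5 mult.assoc)

lemma substK_pow_add: "(substK A ^^ n) (f + g) = (substK A ^^ n) f + (substK A ^^ n) g"
  by (induction n) (simp_all add: substK_simps)

lemma substK_pow_sum: "(substK A ^^ n) (\<Sum>i\<in>I. f i) = (\<Sum>i\<in>I. (substK A ^^ n) (f i))"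
  by (induction n) (simp_all add: substK_simps)

lemma substK_pow_Const_mult: "(substK A ^^ n) (Const c * f) = Const c * (substK A ^^ n) f"
  by (induction n) (simp_all add: substK_simps)

lemma substK_pow_hitK: "f \<in> hitK \<Longrightarrow> (substK A ^^ n) f \<in> hitK"
  by (induction n) (simp_all add: substK_hitK)

lemma substK_pow_invariant: "f + substK A f \<in> hitK \<Longrightarrow> f + (substK A ^^ n) f \<in> hitK"
proof (induction n)
  case (Suc n)
  have "substK A (f + (substK A ^^ n) f) \<in> hitK"
    using Suc by (simp add: substK_hitK)
  with Suc.prems have "(f + substK A f) + substK A (f + (substK A ^^ n) f) \<in> hitK"
    by (rule hitK.add)
  then show ?case
    by (simp add: substK_simps add.assoc)
qed (simp add: hitK.zero)

lemma substK_pow_singer: "(substK singer ^^ k) (eig_mono 0 m) = Const ((gen ^ weight m) ^ k) * eig_mono 0 m"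
  by (induction k) (simp_all add: substK_simps(1-3,5-9) substK_singer_eig_mono Const_mult mult_ac)

lemma substK_pow_rotation: "(substK rotation ^^ n) (eig_mono 0 m) = eig_mono (of_nat n) m"
  by (induction n) (simp_all add: substK_rotation_eig_mono add.commute)

lemma sum_of_nat_5: "(\<Sum>n<5. h (of_nat n)) = (\<Sum>i\<in>(UNIV :: 5 set). h i)"
  by (simp add: sum_5 numeral_eq_Suc add.assoc)

definition average :: "P5K \<Rightarrow> P5K" where
  "average f = (\<Sum>n<5. \<Sum>k<31. (substK rotation ^^ n) ((substK singer ^^ k) f))"

lemma average_sum: "average (\<Sum>i\<in>I. f i) = (\<Sum>i\<in>I. average (f i))"
  unfolding average_def substK_pow_sum
  by (simp add: sum.swap[of _ _ I])

lemma average_Const_mult: "average (Const c * f) = Const c * average f"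
  by (simp add: average_def substK_pow_Const_mult sum_distrib_left)

lemma average_eig_mono_generated:
  assumes "(\<Sum>j\<in>UNIV. Poly_Mapping.lookup m j) = 11"
  shows "average (eig_mono 0 m) \<in> generated"
proof -
  have "average (eig_mono 0 m) = (\<Sum>n<5. Const (\<Sum>k<31. (gen ^ weight m) ^ k) * eig_mono (of_nat n) m)"
    by (simp add: average_def substK_pow_singer substK_pow_Const_mult substK_pow_rotation Const_sum
        sum_distrib_right)
  also have "\<dots> = Const (\<Sum>k<31. (gen ^ weight m) ^ k) * (\<Sum>i\<in>UNIV. eig_mono i m)"
    unfolding sum_distrib_left by (rule sum_of_nat_5)
  finally have eq: "average (eig_mono 0 m) = Const (\<Sum>k<31. (gen ^ weight m) ^ k) * (\<Sum>i\<in>UNIV. eig_mono i m)" .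
  show ?thesis
  proof (cases "31 dvd weight m")
    case True
    then have "(\<Sum>i\<in>UNIV. eig_mono i m) \<in> generated"
      unfolding sum_eig_mono using assms by (intro orb_weight_zero) (simp_all add: sum_5 weight_def)
    then show ?thesis
      by (simp add: eq generated_Const_mult)
  next
    case False
    then show ?thesis
      using gen_power_sum[OF False] by (simp add: eq hitK_generated hitK.zero)
  qed
qed

lemma average_invariant:
  assumes "f + substK singer f \<in> hitK" "f + substK rotation f \<in> hitK"
  shows "f + average f \<in> hitK"
proof -
  have "f + (substK rotation ^^ n) ((substK singer ^^ k) f) \<in> hitK" for n k
  proof -
    have "(substK rotation ^^ n) (f + (substK singer ^^ k) f) \<in> hitK"
      by (intro substK_pow_hitK substK_pow_invariant assms)
    then have "(f + (substK rotation ^^ n) f) + (substK rotation ^^ n) (f + (substK singer ^^ k) f) \<in> hitK"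
      by (intro hitK.add substK_pow_invariant assms)
    then show ?thesis
      by (simp add: substK_pow_add add.assoc)
  qed
  then have "(\<Sum>n<5. \<Sum>k<31. f + (substK rotation ^^ n) ((substK singer ^^ k) f)) \<in> hitK"
    by (intro hitK_sum)
  then show ?thesis
    by (simp add: sum.distrib average_def)
qed

lemma invariant_hit:
  assumes "homogeneous 11 f" and inv: "\<And>A. A \<in> GL5 \<Longrightarrow> subst_action A f - f \<in> hit"
  shows "f \<in> hit"
proof -
  let ?f = "base_change f"
  obtain g where g: "homK 11 g"
    "?f = (\<Sum>m\<in>Poly_Mapping.keys g. Const (Poly_Mapping.lookup g m) * eig_mono 0 m)"
    using assms(1) by (rule eig_expansion)
  have "average ?f = (\<Sum>m\<in>Poly_Mapping.keys g. Const (Poly_Mapping.lookup g m) * average (eig_mono 0 m))"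
    by (simp only: g(2) average_sum average_Const_mult)
  also have "\<dots> \<in> generated"
    using g(1) by (intro generated_sum generated_Const_mult average_eig_mono_generated) (simp add: homK_def)
  finally have avg: "average ?f \<in> generated" .
  have inv': "?f + substK A ?f \<in> hitK" if "A \<in> GL5" for A
  proof -
    have "base_change (subst_action A f - f) \<in> hitK"
      using inv[OF that] by (simp add: base_change_hit_iff)
    then show ?thesis
      by (simp add: base_change_diff substK_base_change add.commute)
  qed
  have "?f + average ?f \<in> generated"
    by (intro hitK_generated average_invariant inv' singer_GL5 rotation_GL5)
  from generated_add[OF this avg] obtain a b where ab: "?f + (Const a * orb 7 2 1 0 1 + Const b * orb 5 3 1 2 0) \<in> hitK"
    by (auto simp: generated_def add.assoc)
  have coeff3: "coeff3 2 i j 7 3 1 (substK shear ?f) + (a * coeff3 2 i j 7 3 1 (substK shear (orb 7 2 1 0 1))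
      + b * coeff3 2 i j 7 3 1 (substK shear (orb 5 3 1 2 0))) = 0" if "distinct [2, i, j]" for i j
  proof -
    have "coeff3 2 i j 7 3 1 (substK shear (?f + (Const a * orb 7 2 1 0 1 + Const b * orb 5 3 1 2 0))) = 0"
      unfolding coeff3_def using that by (intro lookup_hitK_spike substK_hitK ab spike_expo) simp_all
    then show ?thesis
      by (simp add: substK_simps(1-3,5-9) coeff3_simps)
  qed
  have zero: "coeff3 2 i j 7 3 1 (substK shear ?f) = 0" if "distinct [2, i, j]" for i j
    unfolding coeff3_def substK_base_change by (rule lookup_invariant[OF that inv shear_GL5])
  have "b = 0"
    using coeff3[of 0 1, unfolded orb_pairing] zero[of 0 1] by simp
  moreover from this have "a = 0"
    using coeff3[of 1 0, unfolded orb_pairing] zero[of 1 0] by simp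
  ultimately have "?f \<in> hitK"
    using ab by simp
  then show ?thesis
    by (simp add: base_change_hit_iff)
qed

theorem proposition1p3:
  shows "{z \<in> cohit_degree 11. \<forall>A\<in>GL5. cohit_action A z = z} = {0}"
proof (intro equalityI subsetI)
  fix z assume "z \<in> {z \<in> cohit_degree 11. \<forall>A\<in>GL5. cohit_action A z = z}"
  then obtain f where f: "homogeneous 11 f" "z = abs_cohit f"
    and inv: "\<And>A. A \<in> GL5 \<Longrightarrow> cohit_action A (abs_cohit f) = abs_cohit f"
    by (auto simp: cohit_degree_def)
  have "subst_action A f - f \<in> hit" if "A \<in> GL5" for A
    using inv[OF that] by (simp add: cohit_action.abs_eq cohit.abs_eq_iff)
  with f show "z \<in> {0}"
    by (simp add: abs_cohit_eq_0_iff invariant_hit)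
next
  fix z :: cohit assume "z \<in> {0}"
  moreover have "homogeneous 11 0"
    by (simp add: homogeneous_def)
  ultimately show "z \<in> {z \<in> cohit_degree 11. \<forall>A\<in>GL5. cohit_action A z = z}"
    by (auto simp: cohit_degree_def zero_cohit_def cohit_action.abs_eq)
qed

end
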